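(* Let $(\boldsymbol{\varepsilon}_H(z),\boldsymbol{\mu}_H(z))$ be a Hermitian photonic crystal, let $\Gamma_0\subset\mathbb{C}$ be the union of its dispersion curves and $\Gamma_0^c=\mathbb{C}\setminus\Gamma_0$. Assume that the spectrum of $(\boldsymbol{\varepsilon}_H,\boldsymbol{\mu}_H)$ contains a band gap (as a result, $\Gamma_0^c$ is a connected and unbounded domain in the complex plane). Then $\Gamma_0^c$ is a principal gapped component, i.e. $\mathrm{Ind}(\Gamma_0^c)=0$, which means $\mathrm{Ind}(\omega)=0$ for every $\omega\in\Gamma_0^c$.
   Context: Medium. A photonic crystal is a pair $(\boldsymbol{\varepsilon},\boldsymbol{\mu})$ of bounded, piecewise continuous, $1$-periodic functions $\mathbb{R}\to\mathbb{C}^{2\times2}$ (transverse blocks of permittivity and permeability). It is Hermitian if $\boldsymbol{\varepsilon}(z)=\boldsymbol{\varepsilon}(z)^*$ and $\boldsymbol{\mu}(z)=\boldsymbol{\mu}(z)^*$ are positive definite. ODE and monodromy matrix. Put $Q=\begin{pmatrix}0&-1\\1&0\end{pmatrix}$, $\mathcal{Q}=\begin{pmatrix}Q&0\\0&Q\end{pmatrix}$, $\mathcal{A}(z)=\mathrm{i}\begin{pmatrix}0&\boldsymbol{\mu}(z)\\-\boldsymbol{\varepsilon}(z)&0\end{pmatrix}$. For $\omega\in\mathbb{C}$ let $\mathcal{T}_\omega(z,z_1)\in\mathbb{C}^{4\times4}$ solve $\frac{d}{dz}\mathcal{T}_\omega(z,z_1)=\omega\mathcal{Q}^{-1}\mathcal{A}(z)\mathcal{T}_\omega(z,z_1)$,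 $\mathcal{T}_\omega(z_1,z_1)=I$, and let $\mathcal{M}(\omega)=\mathcal{T}_\omega(1,0)$, with eigenvalues $\lambda_1(\omega),\dots,\lambda_4(\omega)$ listed with algebraic multiplicity. Spectrum. For $k\in[-\pi,\pi]$, $\omega\in\mathbb{C}$ is an eigenfrequency at $k$ if $\Phi'(z)=\omega\mathcal{Q}^{-1}\mathcal{A}(z)\Phi(z)$, $\Phi(z+1)=e^{\mathrm{i}k}\Phi(z)$ has a nonzero solution $\Phi:\mathbb{R}\to\mathbb{C}^4$. The union of dispersion curves $\Gamma$ is the set of all eigenfrequencies over all $k\in[-\pi,\pi]$; equivalently $\Gamma=\{\omega\in\mathbb{C}:|\lambda_j(\omega)|=1\text{ for some }j\}$. Band gap. For a Hermitian crystal and each $k$, the eigenfrequencies are real, and the non-negative ones are ordered (with multiplicity, as square roots of the eigenvalues $\omega^2$ of the equivalent second-order self-adjoint problem for the electric field) as $\omega_1(k)\le\omega_2(k)\le\cdots$, each $\omega_n$ being continuous in $k$. The spectrum contains a band gap if $\max_{k}\omega_n(k)<\min_{k}\omega_{n+1}(k)$ for some $n\ge1$. Index. $\mathrm{Ind}(\omega)=\frac12\big(\#\{i:|\lambda_i(\omega)|<1\}-\#\{i:|\lambda_i(\omega)|>1\}\big)$. It is constant on each connected component $D$ of $\mathbb{C}\setminus\Gamma$, and $\mathrm{Ind}(D)$ denotes the common value. $D$ is a principal gapped component if $\mathrm{Ind}(D)=0$. *)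

theory Defs
  imports
    "HOL-Analysis.Analysis"
    "HOL-Library.Function_Algebras"
    "HOL-Computational_Algebra.Polynomial"
begin

section \<open>Media\<close>

text \<open>One-sided limits at the discontinuities are not required; boundedness is imposed separately.\<close>

definition piecewise_continuous :: "(real \<Rightarrow> 'a::topological_space) \<Rightarrow> bool" where
  "piecewise_continuous f \<longleftrightarrow> (\<forall>a b. finite {z \<in> {a..b}. \<not> isCont f z})"

definition photonic_crystal ::
  "(real \<Rightarrow> complex^2^2) \<Rightarrow> (real \<Rightarrow> complex^2^2) \<Rightarrow> bool" where
  "photonic_crystal \<epsilon> \<mu> \<longleftrightarrow>
     bounded (range \<epsilon>) \<and> bounded (range \<mu>) \<and>
     piecewise_continuous \<epsilon> \<and> piecewise_continuous \<mu> \<and>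
     (\<forall>z. \<epsilon> (z + 1) = \<epsilon> z) \<and> (\<forall>z. \<mu> (z + 1) = \<mu> z)"

definition conj_transpose :: "complex^'n^'m \<Rightarrow> complex^'m^'n" where
  "conj_transpose A = (\<chi> i j. cnj (A $ j $ i))"

text \<open>For \<open>A = A\<^sup>*\<close> the form \<open>v\<^sup>* A v\<close> is real, so taking its real part loses nothing.\<close>

definition hermitian_pos_def :: "complex^'n^'n \<Rightarrow> bool" where
  "hermitian_pos_def A \<longleftrightarrow>
     A = conj_transpose A \<and>
     (\<forall>v. v \<noteq> 0 \<longrightarrow> 0 < Re (\<Sum>i\<in>UNIV. cnj (v $ i) * (A *v v) $ i))"

definition hermitian_crystal ::
  "(real \<Rightarrow> complex^2^2) \<Rightarrow> (real \<Rightarrow> complex^2^2) \<Rightarrow> bool" where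
  "hermitian_crystal \<epsilon> \<mu> \<longleftrightarrow>
     photonic_crystal \<epsilon> \<mu> \<and> (\<forall>z. hermitian_pos_def (\<epsilon> z) \<and> hermitian_pos_def (\<mu> z))"

section \<open>The first-order system and its monodromy matrix\<close>

text \<open>Vectors of length four and four-by-four matrices are indexed by the sum type \<open>2 + 2\<close>:
  \<open>Inl\<close> is the electric, \<open>Inr\<close> the magnetic half.\<close>

definition block_matrix ::
  "complex^2^2 \<Rightarrow> complex^2^2 \<Rightarrow> complex^2^2 \<Rightarrow> complex^2^2 \<Rightarrow> complex^(2+2)^(2+2)" where
  "block_matrix A B C D = (\<chi> i j.
     case i of
       Inl a \<Rightarrow> (case j of Inl b \<Rightarrow> A $ a $ b | Inr b \<Rightarrow> B $ a $ b)
     | Inr a \<Rightarrow> (case j of Inl b \<Rightarrow> C $ a $ b | Inr b \<Rightarrow> D $ a $ b))"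

definition rotQ :: "complex^2^2" where
  "rotQ = vector [vector [0, -1], vector [1, 0]]"

definition calQ :: "complex^(2+2)^(2+2)" where
  "calQ = block_matrix rotQ 0 0 rotQ"

definition calA ::
  "(real \<Rightarrow> complex^2^2) \<Rightarrow> (real \<Rightarrow> complex^2^2) \<Rightarrow> real \<Rightarrow> complex^(2+2)^(2+2)" where
  "calA \<epsilon> \<mu> z = mat \<i> ** block_matrix 0 (\<mu> z) (- \<epsilon> z) 0"

definition system_matrix ::
  "(real \<Rightarrow> complex^2^2) \<Rightarrow> (real \<Rightarrow> complex^2^2) \<Rightarrow> complex \<Rightarrow> real \<Rightarrow> complex^(2+2)^(2+2)" where
  "system_matrix \<epsilon> \<mu> \<omega> z = mat \<omega> ** matrix_inv calQ ** calA \<epsilon> \<mu> z"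

text \<open>For piecewise continuous coefficients a solution is a continuous function satisfying the
  equation at every point where both coefficients are continuous.\<close>

definition coeffs_cont :: 
  "(real \<Rightarrow> complex^2^2) \<Rightarrow> (real \<Rightarrow> complex^2^2) \<Rightarrow> real \<Rightarrow> bool" where
  "coeffs_cont \<epsilon> \<mu> z \<longleftrightarrow> isCont \<epsilon> z \<and> isCont \<mu> z"

definition propagator ::
  "(real \<Rightarrow> complex^2^2) \<Rightarrow> (real \<Rightarrow> complex^2^2) \<Rightarrow> complex \<Rightarrow> real \<Rightarrow> real
    \<Rightarrow> complex^(2+2)^(2+2)" where
  "propagator \<epsilon> \<mu> \<omega> z z\<^sub>1 =
     (THE T. continuous_on UNIV T \<and> T z\<^sub>1 = mat 1 \<and>
        (\<forall>x. coeffs_cont \<epsilon> \<mu> x \<longrightarrow>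
           (T has_vector_derivative (system_matrix \<epsilon> \<mu> \<omega> x ** T x)) (at x))) z"

definition monodromy ::
  "(real \<Rightarrow> complex^2^2) \<Rightarrow> (real \<Rightarrow> complex^2^2) \<Rightarrow> complex \<Rightarrow> complex^(2+2)^(2+2)" where
  "monodromy \<epsilon> \<mu> \<omega> = propagator \<epsilon> \<mu> \<omega> 1 0"

definition charpoly :: "complex^'n^'n \<Rightarrow> complex poly" where
  "charpoly A = det (\<chi> i j. (if i = j then [:0, 1:] else 0) - [:A $ i $ j:])"

text \<open>Eigenvalues with algebraic multiplicity, as the multiset of roots of \<open>det (X - A)\<close>.\<close>

definition eigenvalues :: "complex^'n^'n \<Rightarrow> complex multiset" where
  "eigenvalues A = proots (charpoly A)"

section \<open>Spectrum\<close>

definition eigenfrequency ::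
  "(real \<Rightarrow> complex^2^2) \<Rightarrow> (real \<Rightarrow> complex^2^2) \<Rightarrow> real \<Rightarrow> complex \<Rightarrow> bool" where
  "eigenfrequency \<epsilon> \<mu> k \<omega> \<longleftrightarrow>
     (\<exists>\<Phi> :: real \<Rightarrow> complex^(2+2).
        (\<exists>z. \<Phi> z \<noteq> 0) \<and>
        continuous_on UNIV \<Phi> \<and>
        (\<forall>z. coeffs_cont \<epsilon> \<mu> z \<longrightarrow>
           (\<Phi> has_vector_derivative (system_matrix \<epsilon> \<mu> \<omega> z *v \<Phi> z)) (at z)) \<and>
        (\<forall>z. \<Phi> (z + 1) = exp (\<i> * of_real k) *s \<Phi> z))"

definition dispersion_union ::
  "(real \<Rightarrow> complex^2^2) \<Rightarrow> (real \<Rightarrow> complex^2^2) \<Rightarrow> complex set" where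
  "dispersion_union \<epsilon> \<mu> = {\<omega>. \<exists>k\<in>{-pi..pi}. eigenfrequency \<epsilon> \<mu> k \<omega>}"

section \<open>Band gap\<close>

text \<open>Eliminating the magnetic field \<open>H\<close> from the first-order system, \<open>\<mu>\<inverse> Q E' = \<i>\<omega> H\<close> and
  \<open>Q H' = - \<i>\<omega> \<epsilon> E\<close>, gives \<open>Q (\<mu>\<inverse> Q E')' = \<omega>\<^sup>2 \<epsilon> E\<close>.  Below, \<open>\<Lambda>\<close> is the eigenvalue
  \<open>\<omega>\<^sup>2\<close> and \<open>G\<close> is the continuous representative of the quasi-derivative \<open>\<mu>\<inverse> Q E'\<close>.
  At \<open>\<omega> = 0\<close>, \<open>k = 0\<close> this problem has multiplicity 2, whereas the first-order
  system has the four-dimensional space of constants.\<close>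

definition electric_eigenspace ::
  "(real \<Rightarrow> complex^2^2) \<Rightarrow> (real \<Rightarrow> complex^2^2) \<Rightarrow> real \<Rightarrow> complex
    \<Rightarrow> (real \<Rightarrow> complex^2) set" where
  "electric_eigenspace \<epsilon> \<mu> k \<Lambda> =
     {E. continuous_on UNIV E \<and>
         (\<forall>z. E (z + 1) = exp (\<i> * of_real k) *s E z) \<and>
         (\<exists>G. continuous_on UNIV G \<and>
            (\<forall>z. coeffs_cont \<epsilon> \<mu> z \<longrightarrow>
               (\<exists>dE. (E has_vector_derivative dE) (at z) \<and>
                     G z = matrix_inv (\<mu> z) *v (rotQ *v dE)) \<and>
               (\<exists>dG. (G has_vector_derivative dG) (at z) \<and>
                     rotQ *v dG = \<Lambda> *s (\<epsilon> z *v E z))))}"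

interpretation field_space:
  vector_space "\<lambda>(c::complex) (E :: real \<Rightarrow> complex^2) z. c *s E z"
  by unfold_locales (auto simp: fun_eq_iff vec_eq_iff algebra_simps)

definition electric_multiplicity ::
  "(real \<Rightarrow> complex^2^2) \<Rightarrow> (real \<Rightarrow> complex^2^2) \<Rightarrow> real \<Rightarrow> real \<Rightarrow> nat" where
  "electric_multiplicity \<epsilon> \<mu> k x =
     field_space.dim (electric_eigenspace \<epsilon> \<mu> k (of_real (x\<^sup>2)))"

text \<open>\<open>w 1 \<le> w 2 \<le> \<dots>\<close> lists the non-negative eigenfrequencies at \<open>k\<close>, each repeated according
  to its multiplicity (\<open>w 0\<close> is not used).  This determines \<open>w n\<close> for \<open>n \<ge> 1\<close>.
  Finiteness is stated because \<open>card\<close> of an infinite set is 0.\<close>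

definition ordered_eigenfrequencies ::
  "(real \<Rightarrow> complex^2^2) \<Rightarrow> (real \<Rightarrow> complex^2^2) \<Rightarrow> real \<Rightarrow> (nat \<Rightarrow> real) \<Rightarrow> bool" where
  "ordered_eigenfrequencies \<epsilon> \<mu> k w \<longleftrightarrow>
     (\<forall>n\<ge>1. 0 \<le> w n \<and> w n \<le> w (Suc n)) \<and>
     (\<forall>x\<ge>0. finite {n. 1 \<le> n \<and> w n = x} \<and>
             card {n. 1 \<le> n \<and> w n = x} = electric_multiplicity \<epsilon> \<mu> k x)"

text \<open>The band functions are continuous on \<open>[-\<pi>, \<pi>]\<close>, so maximum and minimum are attained.\<close>

definition has_band_gap ::
  "(real \<Rightarrow> complex^2^2) \<Rightarrow> (real \<Rightarrow> complex^2^2) \<Rightarrow> bool" where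
  "has_band_gap \<epsilon> \<mu> \<longleftrightarrow>
     (\<exists>w :: nat \<Rightarrow> real \<Rightarrow> real.
        (\<forall>k\<in>{-pi..pi}. ordered_eigenfrequencies \<epsilon> \<mu> k (\<lambda>n. w n k)) \<and>
        (\<exists>n\<ge>1. \<exists>k\<^sub>1 k\<^sub>2.
           is_arg_max (w n) (\<lambda>k. k \<in> {-pi..pi}) k\<^sub>1 \<and>
           is_arg_min (w (Suc n)) (\<lambda>k. k \<in> {-pi..pi}) k\<^sub>2 \<and>
           w n k\<^sub>1 < w (Suc n) k\<^sub>2))"

section \<open>Index\<close>

definition gap_index ::
  "(real \<Rightarrow> complex^2^2) \<Rightarrow> (real \<Rightarrow> complex^2^2) \<Rightarrow> complex \<Rightarrow> real" where
  "gap_index \<epsilon> \<mu> \<omega> =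
     (real (size {# l \<in># eigenvalues (monodromy \<epsilon> \<mu> \<omega>). norm l < 1 #})
      - real (size {# l \<in># eigenvalues (monodromy \<epsilon> \<mu> \<omega>). norm l > 1 #})) / 2"

text \<open>The common value of the index on a component \<open>D\<close>.\<close>

definition component_index ::
  "(real \<Rightarrow> complex^2^2) \<Rightarrow> (real \<Rightarrow> complex^2^2) \<Rightarrow> complex set \<Rightarrow> real" where
  "component_index \<epsilon> \<mu> D = (THE c. \<forall>\<omega>\<in>D. gap_index \<epsilon> \<mu> \<omega> = c)"

definition principal_gapped_component ::
  "(real \<Rightarrow> complex^2^2) \<Rightarrow> (real \<Rightarrow> complex^2^2) \<Rightarrow> complex set \<Rightarrow> bool" where
  "principal_gapped_component \<epsilon> \<mu> D \<longleftrightarrow>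
     D \<in> components (UNIV - dispersion_union \<epsilon> \<mu>) \<and> component_index \<epsilon> \<mu> D = 0"

end

theory Submission
  imports Defs "HOL-Computational_Algebra.Fundamental_Theorem_Algebra"
begin

text \<open>Let \<open>J\<close> be the Hermitian matrix of the energy flux \<open>2 Re (E\<^sup>* Q H)\<close>.  The system matrix \<open>S\<close> satisfies
  \<open>S\<^sup>* J + J S = 2 Im \<omega> diag(\<epsilon>, \<mu>)\<close>.  Hence the flux of a quasi-periodic solution, which is periodic, would be
  strictly monotone for non-real \<open>\<omega>\<close>, so that \<open>\<Gamma>\<^sub>0\<close> is real and its complement, which by the band gap contains
  a real point, is connected through that point.  For real \<open>\<omega>\<close> the monodromy matrix satisfies \<open>M\<^sup>* J M = J\<close>,
  so its spectrum is invariant under \<open>\<lambda> \<mapsto> 1 / cnj \<lambda>\<close> and the index vanishes there.  The index is locally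
  constant off \<open>\<Gamma>\<^sub>0\<close> because \<open>M\<close> depends continuously on \<open>\<omega>\<close>, hence it vanishes on the whole complement.\<close>

section \<open>Linear equations with piecewise continuous coefficients\<close>

text \<open>The gap hypothesis speaks of the second-order problem for the electric field, the index
  of the first-order system. The two are matched at \<omega> \<noteq> 0, where the magnetic field is
  the quasi-derivative divided by i\<omega>; a point strictly above a non-negative band function is
  such a frequency. This point does double duty: it joins the two half planes, and it is where the
  symmetry of the spectrum fixes the index, since for non-real \<omega> the flux is not conserved.

  The coefficients may lack one-sided limits at their discontinuities, so they cannot be extended
  continuously up to them. The analysis therefore rests on forms of the fundamental theorem of
  calculus that tolerate finitely many exceptional points. Conventions also matter:
  \<open>propagator\<close> is a definite description, so existence and uniqueness on the whole line
  must be established, and \<open>field_space.dim\<close> is 0 on infinite-dimensional spaces, so a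
  nonzero eigenfunction alone does not make a multiplicity positive.\<close>

lemma mono_piecewise_derivative:
  fixes f :: "real \<Rightarrow> real"
  assumes "a \<le> b" "finite F" "continuous_on {a..b} f"
    and der: "\<And>z. z \<in> {a<..<b} - F \<Longrightarrow> \<exists>d\<ge>0. (f has_vector_derivative d) (at z)"
  shows "f a \<le> f b"
proof -
  obtain f' where f': "\<And>z. z \<in> {a<..<b} - F \<Longrightarrow> f' z \<ge> 0 \<and> (f has_vector_derivative f' z) (at z)"
    using der by metis
  \<comment> \<open>The gauge integral recovers \<open>f\<close> from its derivative across finitely
    many exceptional points at which \<open>f\<close> is continuous; the integrand is set to 0
    there.\<close>
  define g where "g z = (if z \<in> {a<..<b} - F then f' z else 0)" for z
  have "(g has_integral (f b - f a)) {a..b}"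
    by (rule fundamental_theorem_of_calculus_interior_strong[OF assms(2,1)])
      (use f' assms(3) in \<open>auto simp: g_def\<close>)
  moreover have "g z \<ge> 0" for z
    using f' by (auto simp: g_def)
  ultimately have "0 \<le> f b - f a"
    by (rule has_integral_nonneg)
  then show ?thesis by simp
qed

text \<open>The function \<open>e\<^sup>-\<^sup>M\<^sup>z (|u|\<^sup>2 + \<delta>\<^sup>2)\<close> with \<open>M = 2 K + 1\<close> is nonincreasing.\<close>

lemma gronwall_piecewise:
  fixes u :: "real \<Rightarrow> 'a::real_inner"
  assumes "a \<le> b" "finite F" "continuous_on {a..b} u" "0 \<le> K"
    and der: "\<And>z. z \<in> {a<..<b} - F \<Longrightarrow>
      \<exists>d. (u has_vector_derivative d) (at z) \<and> norm d \<le> K * norm (u z) + \<delta>"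
    and "u a = 0"
  shows "(norm (u b))\<^sup>2 \<le> \<delta>\<^sup>2 * (exp ((2 * K + 1) * (b - a)) - 1)"
proof -
  define M where "M = 2 * K + 1"
  define g where "g z = - (exp (- (M * z)) * (u z \<bullet> u z + \<delta>\<^sup>2))" for z
  have "g a \<le> g b"
  proof (rule mono_piecewise_derivative[OF assms(1,2)])
    show "continuous_on {a..b} g"
      unfolding g_def by (intro continuous_intros assms(3))
    fix z assume z: "z \<in> {a<..<b} - F"
    from der[OF z] obtain d where d: "(u has_vector_derivative d) (at z)"
      "norm d \<le> K * norm (u z) + \<delta>" by blast
    have "((\<lambda>z. u z \<bullet> u z) has_vector_derivative (u z \<bullet> d + d \<bullet> u z)) (at z)"
      by (rule bounded_bilinear.has_vector_derivative[OF bounded_bilinear_inner d(1) d(1)])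
    then have du: "((\<lambda>z. u z \<bullet> u z) has_field_derivative (2 * (u z \<bullet> d))) (at z)"
      by (simp add: has_real_derivative_iff_has_vector_derivative inner_commute)
    define d' where "d' = exp (- (M * z)) * (M * (u z \<bullet> u z + \<delta>\<^sup>2) - 2 * (u z \<bullet> d))"
    have "(g has_field_derivative d') (at z)"
      unfolding g_def d'_def by (auto intro!: derivative_eq_intros du simp: algebra_simps)
    moreover have "0 \<le> d'"
    proof -
      have "u z \<bullet> d \<le> norm (u z) * norm d"
        by (rule norm_cauchy_schwarz)
      also have "\<dots> \<le> norm (u z) * (K * norm (u z) + \<delta>)"
        using d(2) by (intro mult_left_mono) auto
      finally have 1: "2 * (u z \<bullet> d) \<le> 2 * K * (norm (u z))\<^sup>2 + 2 * (norm (u z) * \<delta>)"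
        by (simp add: power2_eq_square algebra_simps)
      \<comment> \<open>The cross term caused by \<delta> is absorbed by the summand 1 in
        \<open>M\<close>. The squared norm stays differentiable where \<open>u\<close>
        vanishes.\<close>
      have 2: "2 * (norm (u z) * \<delta>) \<le> (norm (u z))\<^sup>2 + \<delta>\<^sup>2"
        using zero_le_power2[of "norm (u z) - \<delta>"] by (simp add: power2_eq_square algebra_simps)
      have 3: "0 \<le> 2 * K * \<delta>\<^sup>2" using assms(4) by simp
      show ?thesis
        unfolding d'_def M_def using 1 2 3
        by (intro mult_nonneg_nonneg) (simp_all add: power2_norm_eq_inner algebra_simps)
    qed
    ultimately show "\<exists>d\<ge>0. (g has_vector_derivative d) (at z)"
      by (auto simp: has_real_derivative_iff_has_vector_derivative)
  qed
  then have "exp (- (M * b)) * ((norm (u b))\<^sup>2 + \<delta>\<^sup>2) \<le> exp (- (M * a)) * \<delta>\<^sup>2"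
    using assms(6) by (simp add: g_def power2_norm_eq_inner)
  then have "exp (M * b) * (exp (- (M * b)) * ((norm (u b))\<^sup>2 + \<delta>\<^sup>2)) \<le> exp (M * b) * (exp (- (M * a)) * \<delta>\<^sup>2)"
    by (intro mult_left_mono) auto
  moreover have "exp (M * b) * exp (- (M * b)) = 1" "exp (M * b) * exp (- (M * a)) = exp (M * (b - a))"
    by (simp_all add: right_diff_distrib flip: exp_add)
  ultimately have "(norm (u b))\<^sup>2 + \<delta>\<^sup>2 \<le> exp (M * (b - a)) * \<delta>\<^sup>2"
    by (metis mult.assoc mult_1)
  then show ?thesis
    by (simp add: M_def algebra_simps)
qed

text \<open>The abstract \<open>L\<close> covers the vector and the matrix equation alike.
  Continuity of the coefficients is phrased through \<open>L s (f s)\<close>, so no topology on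
  operators has to be chosen. The bound by \<open>C\<close> holds at irregular points too.\<close>

locale piecewise_linear_ode =
  fixes L :: "real \<Rightarrow> 'a::euclidean_space \<Rightarrow> 'a" and R :: "real set" and C :: real
  assumes finite_irregular: "finite ({a..b} - R)"
    and linear_L: "linear (L z)"
    and norm_L: "norm (L z x) \<le> C * norm x"
    and isCont_L: "z \<in> R \<Longrightarrow> isCont f z \<Longrightarrow> isCont (\<lambda>s. L s (f s)) z"
    and C_pos: "0 < C"
begin

definition solves :: "(real \<Rightarrow> 'a) \<Rightarrow> bool" where
  "solves u \<longleftrightarrow> continuous_on UNIV u \<and> (\<forall>z\<in>R. (u has_vector_derivative L z (u z)) (at z))"

lemma solves_diff: "solves u \<Longrightarrow> solves v \<Longrightarrow> solves (\<lambda>z. u z - v z)"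
  unfolding solves_def
  by (auto intro!: continuous_intros has_vector_derivative_diff simp: linear_diff[OF linear_L])

text \<open>Gronwall with \<delta> = 0 settles the points to the right of \<open>z0\<close>. To the
  left it is applied to the reflected function, whose exceptional set is the reflected one.\<close>

lemma solves_0:
  assumes u: "solves u" and "u z0 = 0"
  shows "u z = 0"
proof (cases "z0 \<le> z")
  case True
  have "(norm (u z))\<^sup>2 \<le> 0\<^sup>2 * (exp ((2 * C + 1) * (z - z0)) - 1)"
    by (rule gronwall_piecewise[OF True finite_irregular[of z0 z]])
      (use u assms(2) C_pos norm_L in \<open>auto simp: solves_def intro: continuous_on_subset\<close>)
  then show ?thesis by simp
next
  case False
  let ?v = "\<lambda>s. u (- s)"
  have "(norm (?v (- z)))\<^sup>2 \<le> 0\<^sup>2 * (exp ((2 * C + 1) * (- z - - z0)) - 1)"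
  proof (rule gronwall_piecewise)
    show "- z0 \<le> - z" "?v (- z0) = 0" "0 \<le> C" using False assms(2) C_pos by auto
    show "finite (uminus ` ({z..z0} - R))" by (intro finite_imageI finite_irregular)
    have cu: "continuous_on UNIV u" using u by (simp add: solves_def)
    show "continuous_on {- z0..- z} ?v"
      by (rule continuous_on_compose2[OF cu]) (auto intro!: continuous_intros)
    fix s assume s: "s \<in> {- z0<..<- z} - uminus ` ({z..z0} - R)"
    have "- s \<in> R"
    proof (rule ccontr)
      assume "- s \<notin> R"
      then have "- s \<in> {z..z0} - R" using s by auto
      then have "- (- s) \<in> uminus ` ({z..z0} - R)" by blast
      then show False using s by simp
    qed
    then have d: "(u has_vector_derivative L (- s) (u (- s))) (at (- s))"
      using u by (simp add: solves_def)
    have m: "(uminus has_vector_derivative - 1) (at s)"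
      by (auto intro!: derivative_eq_intros)
    have "(?v has_vector_derivative - L (- s) (u (- s))) (at s)"
      using vector_diff_chain_at[OF m, of u] d by (simp add: o_def)
    then show "\<exists>d. (?v has_vector_derivative d) (at s) \<and> norm d \<le> C * norm (?v s) + 0"
      using norm_L[of "- s" "u (- s)"] by auto
  qed
  then show ?thesis by simp
qed

lemma solves_unique: "solves u \<Longrightarrow> solves v \<Longrightarrow> u z0 = v z0 \<Longrightarrow> u z = v z"
  using solves_0[OF solves_diff, of u v z0 z] by simp

section \<open>Existence on the whole line by Picard iteration\<close>

text \<open>Off finitely many points of the interval the integrand is continuous, hence measurable,
  and it is dominated by \<open>C * norm (f s)\<close>.\<close>

lemma integrable_L:
  assumes cf: "continuous_on UNIV f"
  shows "(\<lambda>s. L s (f s)) integrable_on {a..b}"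
proof -
  define S where "S = {a..b} \<inter> R"
  have Seq: "S = {a..b} - ({a..b} - R)" by (auto simp: S_def)
  have Sm: "S \<in> sets lebesgue"
    unfolding Seq
    by (rule sets.Diff) (rule lmeasurable_interval(1)[THEN fmeasurableD, simplified box_real] negligible_imp_sets negligible_finite finite_irregular)+
  have c: "continuous_on S (\<lambda>s. L s (f s))"
    by (rule continuous_at_imp_continuous_on)
      (use cf in \<open>auto simp: S_def continuous_on_eq_continuous_at intro!: isCont_L\<close>)
  have "(\<lambda>s. L s (f s)) integrable_on S"
  proof (rule measurable_bounded_by_integrable_imp_integrable)
    show "(\<lambda>s. L s (f s)) \<in> borel_measurable (lebesgue_on S)"
      by (rule continuous_imp_measurable_on_sets_lebesgue[OF c Sm])
    have "(\<lambda>s. C * norm (f s)) integrable_on {a..b}"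
      by (rule integrable_continuous_interval) (auto intro!: continuous_intros continuous_on_subset[OF cf])
    then show "(\<lambda>s. C * norm (f s)) integrable_on S"
      by (rule integrable_spike_set)
        (auto simp: S_def intro!: negligible_subset[OF negligible_finite[OF finite_irregular[of a b]]])
  qed (use norm_L Sm in auto)
  then show ?thesis
    by (rule integrable_spike_set)
      (auto simp: S_def intro!: negligible_subset[OF negligible_finite[OF finite_irregular[of a b]]])
qed

text \<open>One of the two integrals vanishes, so this is the integral from \<open>0\<close> to \<open>z\<close> with orientation.\<close>

definition primitive :: "(real \<Rightarrow> 'a) \<Rightarrow> real \<Rightarrow> 'a" where
  "primitive f z = integral {0..z} (\<lambda>s. L s (f s)) - integral {z..0} (\<lambda>s. L s (f s))"

text \<open>Moves the base point of the oriented integral from 0 to any \<open>a\<close> left of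
  \<open>z\<close>, so that facts about indefinite integrals on a small interval apply. The cases
  are the positions of 0 relative to \<open>a\<close> and \<open>z\<close>.\<close>

lemma primitive_diff:
  assumes cf: "continuous_on UNIV f" and "a \<le> z"
  shows "primitive f z = primitive f a + integral {a..z} (\<lambda>s. L s (f s))"
proof -
  let ?g = "\<lambda>s. L s (f s)"
  have c: "integral {p..q} ?g + integral {q..r} ?g = integral {p..r} ?g" if "p \<le> q" "q \<le> r" for p q r
    by (rule Henstock_Kurzweil_Integration.integral_combine[OF that integrable_L[OF cf]])
  have e: "integral {p..q} ?g = 0" if "q \<le> p" for p q
    using that by (cases "p = q") auto
  consider "0 \<le> a" | "a \<le> 0" "0 \<le> z" | "z \<le> 0" by linarith
  then show ?thesis
  proof cases
    case 1
    then show ?thesis using c[OF 1 assms(2)] e[OF 1] e[of 0 z] assms(2) by (simp add: primitive_def)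
  next
    case 2
    have "primitive f z - primitive f a = integral {0..z} ?g + integral {a..0} ?g"
      using e[OF 2(1)] e[OF 2(2)] by (simp add: primitive_def)
    then show ?thesis using c[OF 2] by (simp add: algebra_simps)
  next
    case 3
    have "primitive f z - primitive f a = integral {a..0} ?g - integral {z..0} ?g"
      using e[OF 3] e[of a 0] 3 assms(2) by (simp add: primitive_def)
    then have "primitive f z - primitive f a = integral {a..z} ?g"
      by (simp flip: c[OF assms(2) 3])
    then show ?thesis by (simp add: diff_eq_eq add.commute)
  qed
qed

lemma primitive_has_vector_derivative:
  assumes cf: "continuous_on UNIV f" and z: "z \<in> R"
  shows "(primitive f has_vector_derivative L z (f z)) (at z)"
proof -
  let ?g = "\<lambda>s. L s (f s)"
  have "isCont ?g z"
    using cf z by (auto simp: continuous_on_eq_continuous_at intro!: isCont_L)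
  then have "((\<lambda>u. integral {z - 1..u} ?g) has_vector_derivative ?g z) (at z within {z - 1..z + 1} - {})"
    by (intro integral_has_vector_derivative_continuous_at integrable_L[OF cf])
      (auto intro: continuous_at_imp_continuous_within)
  then have "((\<lambda>u. integral {z - 1..u} ?g) has_vector_derivative ?g z) (at z)"
    by (simp add: at_within_Icc_at)
  then have "((\<lambda>u. primitive f (z - 1) + integral {z - 1..u} ?g) has_vector_derivative 0 + ?g z) (at z)"
    by (intro has_vector_derivative_add has_vector_derivative_const)
  then have "((\<lambda>u. primitive f (z - 1) + integral {z - 1..u} ?g) has_vector_derivative ?g z) (at z)"
    by simp
  then show ?thesis
    by (rule has_vector_derivative_transform_within_open[where S = "{z - 1<..<z + 1}"])
      (auto intro: primitive_diff[OF cf, symmetric])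
qed

lemma continuous_primitive:
  assumes cf: "continuous_on UNIV f"
  shows "continuous_on UNIV (primitive f)"
proof -
  have "isCont (primitive f) z" for z
  proof -
    have "continuous_on {z - 1..z + 1} (\<lambda>u. primitive f (z - 1) + integral {z - 1..u} (\<lambda>s. L s (f s)))"
      by (intro continuous_intros indefinite_integral_continuous_1 integrable_L[OF cf])
    then have "continuous_on {z - 1..z + 1} (primitive f)"
      by (rule continuous_on_eq) (auto intro: primitive_diff[OF cf, symmetric])
    then show ?thesis
      by (rule continuous_on_interior) auto
  qed
  then show ?thesis by (simp add: continuous_on_eq_continuous_at)
qed

lemma primitive_minus:
  assumes "continuous_on UNIV f" "continuous_on UNIV g"
  shows "primitive f z - primitive g z = primitive (\<lambda>s. f s - g s) z"
  unfolding primitive_def linear_diff[OF linear_L]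
  using assms by (simp add: integral_diff integrable_L)

text \<open>The integral of C K exp(2 C s) from 0 to |z| is at most K/2 exp(2 C |z|): the factor 1/2
  arises because the weight grows at twice the rate \<open>C\<close>.\<close>

lemma primitive_bound:
  assumes cf: "continuous_on UNIV f" and b: "\<And>s. norm (f s) \<le> K * exp (2 * C * \<bar>s\<bar>)"
  shows "norm (primitive f z) \<le> K / 2 * exp (2 * C * \<bar>z\<bar>)"
proof -
  let ?g = "\<lambda>s. L s (f s)"
  have K: "0 \<le> K" using b[of 0] norm_ge_zero[of "f 0"] by (simp del: norm_ge_zero)
  have g: "norm (?g s) \<le> C * (K * exp (2 * C * \<bar>s\<bar>))" for s
    using norm_L[of s "f s"] mult_left_mono[OF b[of s], of C] C_pos by linarith
  show ?thesis
  proof (cases "0 \<le> z")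
    case True
    have h: "((\<lambda>s. C * (K * exp (2 * C * s))) has_integral (K / 2 * exp (2 * C * z) - K / 2 * exp (2 * C * 0))) {0..z}"
      by (rule fundamental_theorem_of_calculus[OF True])
        (auto intro!: derivative_eq_intros simp flip: has_real_derivative_iff_has_vector_derivative)
    have "norm (integral {0..z} ?g) \<le> integral {0..z} (\<lambda>s. C * (K * exp (2 * C * s)))"
    proof (rule integral_norm_bound_integral[OF integrable_L[OF cf] has_integral_integrable[OF h]])
      show "norm (?g s) \<le> C * (K * exp (2 * C * s))" if "s \<in> {0..z}" for s
        using g[of s] that by simp
    qed
    also have "\<dots> = K / 2 * exp (2 * C * z) - K / 2" using integral_unique[OF h] by simp
    finally have "norm (integral {0..z} ?g) \<le> K / 2 * exp (2 * C * z)" using K by simp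
    moreover have "integral {z..0} ?g = 0" using True by (cases "z = 0") auto
    ultimately show ?thesis using True by (simp add: primitive_def)
  next
    case False
    have h: "((\<lambda>s. C * (K * exp (- (2 * C * s)))) has_integral (- (K / 2 * exp (- (2 * C * 0))) - - (K / 2 * exp (- (2 * C * z))))) {z..0}"
      by (rule fundamental_theorem_of_calculus)
        (use False in \<open>auto intro!: derivative_eq_intros simp flip: has_real_derivative_iff_has_vector_derivative\<close>)
    have "norm (integral {z..0} ?g) \<le> integral {z..0} (\<lambda>s. C * (K * exp (- (2 * C * s))))"
    proof (rule integral_norm_bound_integral[OF integrable_L[OF cf] has_integral_integrable[OF h]])
      show "norm (?g s) \<le> C * (K * exp (- (2 * C * s)))" if "s \<in> {z..0}" for s
        using g[of s] that by simp
    qed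
    also have "\<dots> = K / 2 * exp (- (2 * C * z)) - K / 2" using integral_unique[OF h] by simp
    finally have "norm (integral {z..0} ?g) \<le> K / 2 * exp (- (2 * C * z))" using K by simp
    then show ?thesis using False by (simp add: primitive_def)
  qed
qed

text \<open>Picard iteration contracts with factor \<open>1/2\<close> in the norm weighted by \<open>exp (- 2 C |z|)\<close>.\<close>

lemma solves_exists: "\<exists>u. solves u \<and> u 0 = x"
proof -
  define W where "W z = exp (2 * C * \<bar>z\<bar>)" for z :: real
  have W: "W z > 0" "1 \<le> W z" for z using C_pos by (auto simp: W_def)
  have cW: "continuous_on A W" for A unfolding W_def by (intro continuous_intros)
  \<comment> \<open>The Picard map in terms of v = u / W. Dividing by the weight turns the weighted
    norm into the supremum norm of \<open>bcontfun\<close>, whose completeness yields a solution on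
    the whole line at once, although \<open>u\<close> itself may grow exponentially.\<close>
  define P where "P v z = inverse (W z) *\<^sub>R (x + primitive (\<lambda>s. W s *\<^sub>R v s) z)" for v z
  have cWv: "continuous_on UNIV (\<lambda>s. W s *\<^sub>R apply_bcontfun v s)" for v :: "real \<Rightarrow>\<^sub>C 'a"
    by (intro continuous_on_scaleR cW continuous_on_apply_bcontfun)
  have bnd: "norm (inverse (W z) *\<^sub>R primitive (\<lambda>s. W s *\<^sub>R v s) z) \<le> K / 2"
    if "continuous_on UNIV v" "\<And>s. norm (v s) \<le> K" for v K z
  proof -
    have "norm (primitive (\<lambda>s. W s *\<^sub>R v s) z) \<le> K / 2 * exp (2 * C * \<bar>z\<bar>)"
    proof (rule primitive_bound)
      show "continuous_on UNIV (\<lambda>s. W s *\<^sub>R v s)" by (intro continuous_intros cW that)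
      show "norm (W s *\<^sub>R v s) \<le> K * exp (2 * C * \<bar>s\<bar>)" for s
        using mult_left_mono[OF that(2)[of s], of "W s"] W(1)[of s] by (simp add: W_def mult.commute)
    qed
    then have "norm (primitive (\<lambda>s. W s *\<^sub>R v s) z) \<le> K / 2 * W z" by (simp add: W_def)
    then show ?thesis using W(1)[of z] by (simp add: field_simps)
  qed
  have Pb: "P (apply_bcontfun v) \<in> bcontfun" for v
  proof (rule bcontfun_normI)
    show "continuous_on UNIV (P (apply_bcontfun v))"
      unfolding P_def using W(1) by (intro continuous_intros cW continuous_primitive cWv) (simp add: less_imp_neq[symmetric])
    fix z
    have "norm (P (apply_bcontfun v) z) \<le> norm (inverse (W z) *\<^sub>R x)
        + norm (inverse (W z) *\<^sub>R primitive (\<lambda>s. W s *\<^sub>R v s) z)"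
      unfolding P_def scaleR_add_right by (rule norm_triangle_ineq)
    also have "\<dots> \<le> norm x + norm v / 2"
    proof (rule add_mono[OF _ bnd])
      show "norm (inverse (W z) *\<^sub>R x) \<le> norm x"
        using W[of z] mult_left_mono[OF W(2)[of z], of "norm x"] by (simp add: field_simps)
    qed (auto simp: norm_bounded)
    finally show "norm (P (apply_bcontfun v) z) \<le> norm x + norm v / 2" .
  qed
  define B where "B v = Bcontfun (P (apply_bcontfun v))" for v
  have B: "apply_bcontfun (B v) = P (apply_bcontfun v)" for v
    unfolding B_def by (rule Bcontfun_inverse[OF Pb])
  have "\<exists>!v. B v = v"
  proof (rule banach_fix_type[where c = "1/2"]; (intro allI)?)
    fix v w
    show "dist (B v) (B w) \<le> 1 / 2 * dist v w"
    proof (rule dist_bound)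
      fix z
      have "B v z - B w z = inverse (W z) *\<^sub>R (primitive (\<lambda>s. W s *\<^sub>R v s) z - primitive (\<lambda>s. W s *\<^sub>R w s) z)"
        by (simp add: B P_def algebra_simps)
      also have "\<dots> = inverse (W z) *\<^sub>R primitive (\<lambda>s. W s *\<^sub>R (v s - w s)) z"
        by (simp add: primitive_minus[OF cWv cWv] scaleR_diff_right)
      finally have "norm (B v z - B w z) \<le> dist v w / 2"
        using bnd[of "\<lambda>s. v s - w s" "dist v w" z]
        by (auto simp: dist_norm[symmetric] dist_bounded intro!: continuous_intros)
      then show "dist (B v z) (B w z) \<le> 1 / 2 * dist v w" by (simp add: dist_norm)
    qed
  qed auto
  then obtain v where v: "B v = v" by blast
  define u where "u z = W z *\<^sub>R apply_bcontfun v z" for z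
  have cu: "continuous_on UNIV u" unfolding u_def by (rule cWv)
  have u: "u z = x + primitive u z" for z
  proof -
    have "apply_bcontfun v z = P (apply_bcontfun v) z" using B[of v] unfolding v by (rule fun_cong)
    moreover have "u = (\<lambda>s. W s *\<^sub>R apply_bcontfun v s)" by (auto simp: u_def)
    ultimately show ?thesis using W(1)[of z] by (simp add: P_def)
  qed
  have "(u has_vector_derivative L z (u z)) (at z)" if "z \<in> R" for z
  proof -
    have "((\<lambda>z. x + primitive u z) has_vector_derivative 0 + L z (u z)) (at z)"
      by (intro has_vector_derivative_add has_vector_derivative_const primitive_has_vector_derivative cu that)
    then show ?thesis by (simp flip: u)
  qed
  moreover have "u 0 = x" by (subst u) (simp add: primitive_def)
  ultimately show ?thesis using cu by (auto simp: solves_def)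
qed

end

section \<open>Characteristic polynomials\<close>

text \<open>The coefficient at \<open>card I\<close> is tracked instead of the leading one because
  factors may be constants, as the off-diagonal entries of X - A are; such a factor makes the
  coefficient vanish.\<close>

lemma prod_degree_le_1:
  fixes f :: "'i \<Rightarrow> 'a::comm_ring_1 poly"
  assumes "finite I" "\<And>i. i \<in> I \<Longrightarrow> degree (f i) \<le> 1"
  shows "degree (prod f I) \<le> card I \<and> coeff (prod f I) (card I) = (\<Prod>i\<in>I. coeff (f i) 1)"
  using assms
proof (induction I)
  case (insert i I)
  define g where "g = prod f I"
  have "f i = [:coeff (f i) 0, coeff (f i) 1:]"
    using insert.prems[of i] by (intro poly_eqI) (auto simp: coeff_pCons coeff_eq_0 split: nat.splits)
  then obtain a b where ab: "f i = [:a, b:]" by blast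
  have g: "degree g \<le> card I" "coeff g (card I) = (\<Prod>i\<in>I. coeff (f i) 1)"
    using insert by (auto simp: g_def)
  have "coeff g (Suc (card I)) = 0"
    using g(1) by (intro coeff_eq_0) simp
  moreover have "degree (f i * g) \<le> 1 + card I"
    using g(1) insert.prems[of i] degree_mult_le[of "f i" g] by (meson add_mono insertI1 order_trans)
  moreover have "prod f (insert i I) = f i * g"
    using insert by (simp add: g_def)
  ultimately show ?case
    using insert.hyps g ab by (simp add: mult_pCons_left)
qed auto

lemma poly_charpoly: "poly (charpoly A) x = det (mat x - A)"
proof -
  have "poly (of_int k) x = of_int k" for k :: int and x :: complex
    by (simp add: of_int_poly)
  then show ?thesis
    unfolding charpoly_def det_def
    by (simp add: poly_sum poly_prod mat_def if_distrib[where f = "\<lambda>p. poly p _"] cong: if_cong)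
qed

text \<open>In each Leibniz product the coefficient of degree \<open>CARD('n)\<close> is the product
  of the linear coefficients of the entries. These form the identity matrix, so the sum over all
  permutations is det I = 1.\<close>

lemma monic_charpoly:
  fixes A :: "complex^'n^'n"
  shows "degree (charpoly A) = CARD('n)" "lead_coeff (charpoly A) = 1"
proof -
  let ?B = "(\<chi> i j. (if i = j then [:0, 1:] else 0) - [:A $ i $ j:]) :: complex poly^'n^'n"
  have B: "degree (?B $ i $ j) \<le> 1" for i j by auto
  have P: "degree (\<Prod>i\<in>UNIV. ?B $ i $ p i) \<le> CARD('n)"
      "coeff (\<Prod>i\<in>UNIV. ?B $ i $ p i) CARD('n) = (\<Prod>i\<in>UNIV. coeff (?B $ i $ p i) 1)" for p
    using prod_degree_le_1[of UNIV "\<lambda>i. ?B $ i $ p i"] B by auto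
  have s: "of_int k * q = smult (of_int k) q" for k and q :: "complex poly"
    by (simp add: of_int_poly)
  have "degree (charpoly A) \<le> CARD('n)"
    unfolding charpoly_def det_def s
    by (intro degree_sum_le order_trans[OF degree_smult_le] P) (simp add: finite_permutations)
  moreover have "coeff (charpoly A) CARD('n) = det (mat 1 :: complex^'n^'n)"
    unfolding charpoly_def det_def s coeff_sum coeff_smult P
    by (intro sum.cong refl arg_cong2[where f = "(*)"] prod.cong) (simp_all add: mat_def)
  ultimately show "degree (charpoly A) = CARD('n)" "lead_coeff (charpoly A) = 1"
    using le_degree[of "charpoly A" "CARD('n)"] by simp_all
qed

text \<open>Indexing the roots by \<open>'n\<close> makes a tuple of roots a vector of
  \<open>complex^'n\<close>, where bounded sequences have convergent subsequences.\<close>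

lemma charpoly_eq_prod:
  fixes A :: "complex^'n^'n"
  obtains r :: "complex^'n" where "charpoly A = (\<Prod>i\<in>UNIV. [:- (r $ i), 1:])"
proof -
  obtain root where root: "smult (lead_coeff (charpoly A)) (\<Prod>i<degree (charpoly A). [:-root i, 1:]) = charpoly A"
    by (rule complex_poly_decompose')
  obtain h where h: "bij_betw h (UNIV :: 'n set) {..<CARD('n)}"
    using ex_bij_betw_finite_nat[of "UNIV :: 'n set"] by (auto simp: atLeast0LessThan)
  have "charpoly A = (\<Prod>i<CARD('n). [:-root i, 1:])"
    using root by (simp add: monic_charpoly monic_charpoly(2)[simplified monic_charpoly(1)])
  also have "\<dots> = (\<Prod>i\<in>UNIV. [:- ((\<chi> i. root (h i)) $ i), 1:])"
    by (subst prod.reindex_bij_betw[OF h, symmetric]) simp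
  finally show thesis by (rule that)
qed

lemma size_filter_sum_singleton:
  "finite I \<Longrightarrow> size (filter_mset P (\<Sum>i\<in>I. {#f i#})) = card {i \<in> I. P (f i)}"
proof (induction I rule: finite_induct)
  case (insert i I)
  have "{j \<in> insert i I. P (f j)} = (if P (f i) then insert i {j \<in> I. P (f j)} else {j \<in> I. P (f j)})"
    by auto
  then show ?case using insert by auto
qed auto

lemma proots_prod_linear: "finite I \<Longrightarrow> proots (\<Prod>i\<in>I. [:- f i, 1:]) = (\<Sum>i\<in>I. {#f i :: complex#})"
  by (subst proots_prod) auto

lemma size_filter_eigenvalues:
  fixes r :: "complex^'n"
  assumes "charpoly A = (\<Prod>i\<in>UNIV. [:- (r $ i), 1:])"
  shows "size (filter_mset P (eigenvalues A)) = card {i. P (r $ i)}"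
  unfolding eigenvalues_def assms by (simp add: proots_prod_linear size_filter_sum_singleton)

lemma det_eq_0_imp_kernel:
  fixes A :: "complex^'n^'n"
  assumes "det A = 0"
  obtains v where "v \<noteq> 0" "A *v v = 0"
proof -
  have "\<not> invertible A"
    using assms by (simp add: invertible_det_nz)
  then show thesis
    using that matrix_left_invertible_ker[of A] invertible_left_inverse[of A] by blast
qed

lemma kernel_imp_det_eq_0:
  fixes A :: "complex^'n^'n"
  assumes "v \<noteq> 0" "A *v v = 0"
  shows "det A = 0"
  using assms matrix_left_invertible_ker[of A] invertible_left_inverse[of A] invertible_det_nz[of A] by blast

lemma mat_mult_vector: "mat c *v (v :: complex^'n) = c *s v"
  by (simp add: vec_eq_iff matrix_vector_mult_def mat_def if_distrib if_distribR cong: if_cong)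

lemma mat_mult_matrix: "mat c ** (A :: complex^'m^'n) = (\<chi> i j. c * A $ i $ j)"
  by (simp add: vec_eq_iff matrix_matrix_mult_def mat_def if_distrib if_distribR cong: if_cong)

lemma norm_vector_smult: "norm (c *s (v :: complex^'n)) = norm c * norm v"
  by (simp add: norm_vec_def norm_mult L2_set_right_distrib)

lemma bilinear_matrix_vector_mult: "bilinear (\<lambda>(A :: complex^'n^'m) v. A *v v)"
  by (simp add: bilinear_def linear_iff matrix_vector_mult_def vec_eq_iff algebra_simps
      sum.distrib scaleR_sum_right)

lemma bilinear_matrix_matrix_mult: "bilinear (\<lambda>(A :: complex^'n^'m) (B :: complex^'k^'n). A ** B)"
  by (simp add: bilinear_def linear_iff matrix_matrix_mult_def vec_eq_iff algebra_simps
      sum.distrib scaleR_sum_right)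

lemmas bounded_bilinear_matrix_vector_mult =
  bilinear_matrix_vector_mult[unfolded bilinear_conv_bounded_bilinear]

lemmas bounded_bilinear_matrix_matrix_mult =
  bilinear_matrix_matrix_mult[unfolded bilinear_conv_bounded_bilinear]

section \<open>Continuity of the eigenvalue counts\<close>

lemma tendsto_det:
  fixes X :: "'b \<Rightarrow> complex^'n^'n"
  assumes "(X \<longlongrightarrow> A) F"
  shows "((\<lambda>n. det (X n)) \<longlongrightarrow> det A) F"
  unfolding det_def by (intro tendsto_intros assms)

text \<open>The roots of the characteristic polynomials stay in a compact set, and a limit point
  of the root vectors is a root vector of the limit.\<close>

lemma eigenvalue_counts_limit:
  fixes X :: "nat \<Rightarrow> complex^'n^'n"
  assumes X: "X \<longlonglongrightarrow> A" and A: "\<And>l. norm l = 1 \<Longrightarrow> det (mat l - A) \<noteq> 0"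
  shows "\<exists>n. size {# l \<in># eigenvalues (X n). norm l < 1 #} = size {# l \<in># eigenvalues A. norm l < 1 #} \<and>
             size {# l \<in># eigenvalues (X n). norm l > 1 #} = size {# l \<in># eigenvalues A. norm l > 1 #}"
proof -
  have "\<forall>n. \<exists>r :: complex^'n. charpoly (X n) = (\<Prod>i\<in>UNIV. [:- (r $ i), 1:])"
    by (metis charpoly_eq_prod)
  then obtain r :: "nat \<Rightarrow> complex^'n" where r: "\<And>n. charpoly (X n) = (\<Prod>i\<in>UNIV. [:- (r n $ i), 1:])"
    by metis
  obtain K where K: "K > 0" "\<And>(B :: complex^'n^'n) v. norm (B *v v) \<le> norm B * norm v * K"
    using bounded_bilinear.pos_bounded[OF bounded_bilinear_matrix_vector_mult] by blast
  obtain M where M: "\<And>n. norm (X n) \<le> M"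
    using convergent_imp_Bseq[of X] X by (auto simp: convergent_def Bseq_def)
  have b: "norm (r n $ i) \<le> M * K" for n i
  proof -
    have "det (mat (r n $ i) - X n) = 0"
      unfolding poly_charpoly[symmetric] r by (simp add: poly_prod) (metis eq_iff_diff_eq_0)
    then obtain v where v: "v \<noteq> 0" "(mat (r n $ i) - X n) *v v = 0"
      by (rule det_eq_0_imp_kernel)
    then have "r n $ i *s v = X n *v v"
      by (simp add: matrix_vector_mult_diff_rdistrib mat_mult_vector)
    then have "norm (r n $ i) * norm v = norm (X n *v v)"
      by (metis norm_vector_smult)
    also have "\<dots> \<le> norm (X n) * norm v * K" by (rule K)
    also have "\<dots> \<le> M * K * norm v" using M[of n] K(1) mult_right_mono[OF M[of n], of "norm v"] by (simp add: mult_ac)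
    finally show ?thesis using v(1) by simp
  qed
  have "norm (r n) \<le> (\<Sum>i\<in>(UNIV :: 'n set). M * K)" for n
    unfolding norm_vec_def by (rule order_trans[OF L2_set_le_sum sum_mono]) (auto intro: b)
  then have "bounded (range r)" by (auto simp: bounded_iff)
  then obtain l s where s: "strict_mono s" and l: "(r \<circ> s) \<longlonglongrightarrow> l"
    by (blast dest: bounded_imp_convergent_subsequence)
  have rl: "(\<lambda>n. r (s n) $ i) \<longlonglongrightarrow> l $ i" for i
    using tendsto_vec_nth[OF l] by (simp add: o_def)
  \<comment> \<open>Both sides are limits of the same values at every x, so the limit vector lists
    the roots of the limit with their multiplicities.\<close>
  have "charpoly A = (\<Prod>i\<in>UNIV. [:- (l $ i), 1:])"
  proof -
    have "poly (charpoly A) x = poly (\<Prod>i\<in>UNIV. [:- (l $ i), 1:]) x" for x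
    proof (rule LIMSEQ_unique)
      have "(\<lambda>n. X (s n)) \<longlonglongrightarrow> A" using LIMSEQ_subseq_LIMSEQ[OF X s] by (simp add: o_def)
      then show "(\<lambda>n. poly (charpoly (X (s n))) x) \<longlonglongrightarrow> poly (charpoly A) x"
        unfolding poly_charpoly by (intro tendsto_det tendsto_intros)
      show "(\<lambda>n. poly (charpoly (X (s n))) x) \<longlonglongrightarrow> poly (\<Prod>i\<in>UNIV. [:- (l $ i), 1:]) x"
        unfolding r poly_prod by (simp, intro tendsto_intros rl)
    qed
    then show ?thesis by (auto simp: poly_eq_poly_eq_iff[symmetric])
  qed
  note cA = this
  \<comment> \<open>Every limit root is thus strictly inside or strictly outside the unit circle,
    and nearby roots are on the same side.\<close>
  have l1: "norm (l $ i) \<noteq> 1" for i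
  proof
    assume "norm (l $ i) = 1"
    then have "poly (charpoly A) (l $ i) \<noteq> 0" using A by (simp add: poly_charpoly)
    then show False unfolding cA by (simp add: poly_prod) (metis eq_iff_diff_eq_0)
  qed
  have "\<forall>\<^sub>F n in sequentially. (norm (r (s n) $ i) < 1 \<longleftrightarrow> norm (l $ i) < 1) \<and> (norm (r (s n) $ i) > 1 \<longleftrightarrow> norm (l $ i) > 1)" for i
  proof (cases "norm (l $ i) < 1")
    case True
    then show ?thesis
      using order_tendstoD(2)[OF tendsto_norm[OF rl[of i]] True] by (auto elim: eventually_mono)
  next
    case False
    then have "1 < norm (l $ i)" using l1[of i] by simp
    then show ?thesis
      using order_tendstoD(1)[OF tendsto_norm[OF rl[of i]], of 1] by (auto elim: eventually_mono)
  qed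
  then have "\<forall>\<^sub>F n in sequentially. \<forall>i. (norm (r (s n) $ i) < 1 \<longleftrightarrow> norm (l $ i) < 1) \<and> (norm (r (s n) $ i) > 1 \<longleftrightarrow> norm (l $ i) > 1)"
    by (intro eventually_all_finite) auto
  then obtain n where "\<And>i. (norm (r (s n) $ i) < 1 \<longleftrightarrow> norm (l $ i) < 1) \<and> (norm (r (s n) $ i) > 1 \<longleftrightarrow> norm (l $ i) > 1)"
    by (auto simp: eventually_sequentially)
  then show ?thesis
    by (intro exI[of _ "s n"]) (simp add: size_filter_eigenvalues[OF r] size_filter_eigenvalues[OF cA])
qed

section \<open>Spectral symmetry of matrices preserving a form\<close>

lemma det_conj_transpose: "det (conj_transpose A) = cnj (det (A :: complex^'n^'n))"
proof -
  have "conj_transpose A = transpose (\<chi> i j. cnj (A $ i $ j))"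
    by (simp add: conj_transpose_def transpose_def vec_eq_iff)
  then have "det (conj_transpose A) = det (\<chi> i j. cnj (A $ i $ j))"
    by (simp add: det_transpose)
  also have "\<dots> = cnj (det A)"
    by (simp add: det_def)
  finally show ?thesis .
qed

lemma det_mat: "det (mat c :: complex^'n^'n) = c ^ CARD('n)"
  by (subst det_diagonal) (auto simp: mat_def)

text \<open>The hypothesis gives (x M^* - I) J M = J (x - M). Determinants then express the
  characteristic polynomial of M through that of M^*, whose roots are the conjugates, so the roots
  r_i are also the numbers 1 / cnj r_i. An identity of polynomials, unlike an argument with
  eigenvectors, keeps the algebraic multiplicities.\<close>

lemma eigenvalues_symmetric:
  fixes M J :: "complex^'n^'n"
  assumes MJM: "conj_transpose M ** J ** M = J" and J: "det J \<noteq> 0"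
  shows "size {# l \<in># eigenvalues M. norm l < 1 #} = size {# l \<in># eigenvalues M. norm l > 1 #}"
proof -
  obtain r :: "complex^'n" where r: "charpoly M = (\<Prod>i\<in>UNIV. [:- (r $ i), 1:])"
    by (rule charpoly_eq_prod)
  define N where "N = conj_transpose M"
  have "det N * det J * det M = det J"
    using arg_cong[OF MJM, of det] by (simp add: det_mul N_def)
  then have dM: "det M \<noteq> 0" using J by auto
  have detm: "det (mat x - M) = (\<Prod>i\<in>UNIV. x - r $ i)" for x
    by (simp add: poly_charpoly[symmetric] r poly_prod)
  have detN: "det (mat x - N) = (\<Prod>i\<in>UNIV. x - cnj (r $ i))" for x
  proof -
    have "mat x - N = conj_transpose (mat (cnj x) - M)"
      by (simp add: N_def conj_transpose_def vec_eq_iff mat_def)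
    then show ?thesis by (simp add: det_conj_transpose detm)
  qed
  have r0: "r $ i \<noteq> 0" for i
  proof
    assume "r $ i = 0"
    then have "det (mat 0 - M) = 0" unfolding detm by (auto intro: prod_zero)
    moreover have "mat 0 - M = mat (-1) ** M" unfolding mat_mult_matrix by (simp add: vec_eq_iff mat_def)
    ultimately show False using dM by (simp add: det_mul det_mat)
  qed
  have key: "det (mat x - M) = det M * (\<Prod>i\<in>UNIV. x * cnj (r $ i) - 1)" if x: "x \<noteq> 0" for x
  proof -
    have "(mat x ** N - mat 1) ** J ** M = mat x ** (N ** J ** M) - J ** M"
      by (simp add: bounded_bilinear.diff_left[OF bounded_bilinear_matrix_matrix_mult] matrix_mul_assoc)
    also have "\<dots> = J ** (mat x - M)"
      unfolding N_def MJM bounded_bilinear.diff_right[OF bounded_bilinear_matrix_matrix_mult] mat_mult_matrix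
      by (simp add: vec_eq_iff matrix_matrix_mult_def mat_def if_distrib if_distribR mult.commute cong: if_cong)
    finally have "det (mat x ** N - mat 1) * det J * det M = det J * det (mat x - M)"
      by (metis det_mul)
    then have "det (mat x - M) = det M * det (mat x ** N - mat 1)" using J by (simp add: mult.commute)
    also have "mat x ** N - mat 1 = mat (- x) ** (mat (1 / x) - N)"
      using x by (simp add: mat_mult_matrix vec_eq_iff) (auto simp: mat_def algebra_simps)
    also have "det \<dots> = (\<Prod>i\<in>UNIV. - x * (1 / x - cnj (r $ i)))"
      by (simp only: det_mul det_mat detN prod.distrib prod_constant)
    also have "\<dots> = (\<Prod>i\<in>UNIV. x * cnj (r $ i) - 1)"
      using x by (intro prod.cong) (auto simp: field_simps)
    finally show ?thesis .
  qed
  define q where "q = smult (det M) (\<Prod>i\<in>UNIV. [:-1, cnj (r $ i):])"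
  \<comment> \<open>\<open>key\<close> involves 1 / x and is available for x \<noteq> 0 only; after
    multiplication by X the values agree at 0 as well, and X cancels.\<close>
  have "poly ([:0, 1:] * charpoly M) x = poly ([:0, 1:] * q) x" for x
    using key[of x] by (cases "x = 0") (simp_all add: poly_charpoly q_def poly_prod mult.commute)
  then have "[:0, 1:] * charpoly M = [:0, 1:] * q"
    by (auto simp: poly_eq_poly_eq_iff[symmetric])
  then have "charpoly M = q" by simp
  also have "q = smult (det M) (\<Prod>i\<in>UNIV. smult (cnj (r $ i)) [:- (1 / cnj (r $ i)), 1:])"
    unfolding q_def using r0 by simp
  also have "\<dots> = smult (det M * (\<Prod>i\<in>UNIV. cnj (r $ i))) (\<Prod>i\<in>UNIV. [:- (1 / cnj (r $ i)), 1:])"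
    by (simp add: prod_smult del: smult_pCons)
  finally have "eigenvalues M = (\<Sum>i\<in>UNIV. {#1 / cnj (r $ i)#})"
    unfolding eigenvalues_def using dM r0 by (simp add: proots_prod_linear del: smult_pCons)
  then have "size {# l \<in># eigenvalues M. norm l < 1 #} = card {i. norm (1 / cnj (r $ i)) < 1}"
    by (simp add: size_filter_sum_singleton)
  also have "\<dots> = card {i. norm (r $ i) > 1}"
    using r0 by (simp add: norm_divide)
  finally show ?thesis by (simp add: size_filter_eigenvalues[OF r])
qed

section \<open>The energy flux\<close>

lemma sum_UNIV_2_plus_2:
  "(\<Sum>i\<in>(UNIV :: (2 + 2) set). f i) = f (Inl 1) + f (Inl 2) + f (Inr 1) + f (Inr 2)"
  by (subst UNIV_Plus_UNIV[symmetric], subst sum.Plus) (simp_all add: UNIV_2 add.assoc)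

lemma forall_2_plus_2:
  "(\<forall>i :: 2 + 2. P i) \<longleftrightarrow> P (Inl 1) \<and> P (Inl 2) \<and> P (Inr 1) \<and> P (Inr 2)"
  by (simp add: split_sum_all forall_2)

lemma rotQ_nth: "rotQ $ 1 $ 1 = 0" "rotQ $ 1 $ 2 = -1" "rotQ $ 2 $ 1 = 1" "rotQ $ 2 $ 2 = 0"
  by (simp_all add: rotQ_def)

lemma rotQ_rotQ: "rotQ *v (rotQ *v x) = - x"
  by (simp add: vec_eq_iff forall_2 matrix_vector_mult_def sum_2 rotQ_nth)

lemma matrix_inv_right:
  fixes A :: "'a::semiring_1^'n^'m"
  assumes "invertible A"
  shows "A ** matrix_inv A = mat 1"
  using someI_ex[OF assms[unfolded invertible_def]] by (simp add: matrix_inv_def)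

text \<open>Q^2 = -I gives Q^-1 = -Q; \<open>matrix_inv\<close> chooses an inverse, and inverses are
  unique.\<close>

lemma matrix_inv_calQ: "matrix_inv calQ = block_matrix (- rotQ) 0 0 (- rotQ)"
proof -
  let ?B = "block_matrix (- rotQ) 0 0 (- rotQ)"
  have 1: "calQ ** ?B = mat 1" "?B ** calQ = mat 1"
    by (simp_all add: vec_eq_iff forall_2_plus_2 matrix_matrix_mult_def sum_UNIV_2_plus_2
        calQ_def block_matrix_def rotQ_nth mat_def)
  then have "invertible calQ" by (auto simp: invertible_def)
  then have "calQ ** matrix_inv calQ = mat 1" by (rule matrix_inv_right)
  then have "?B ** (calQ ** matrix_inv calQ) = ?B" by simp
  then show ?thesis by (simp add: matrix_mul_assoc 1(2))
qed

definition electric_part :: "complex^(2+2) \<Rightarrow> complex^2" where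
  "electric_part v = (\<chi> a. v $ Inl a)"

definition magnetic_part :: "complex^(2+2) \<Rightarrow> complex^2" where
  "magnetic_part v = (\<chi> a. v $ Inr a)"

text \<open>The argument is a pair so that this is a bounded linear map on a product space;
  continuity and derivatives of (E, H) then come from those of the components.\<close>

definition join_parts :: "(complex^2) \<times> (complex^2) \<Rightarrow> complex^(2+2)" where
  "join_parts p = (\<chi> i. case i of Inl a \<Rightarrow> fst p $ a | Inr a \<Rightarrow> snd p $ a)"

lemma parts_join [simp]:
  "electric_part (join_parts (e, h)) = e" "magnetic_part (join_parts (e, h)) = h"
  by (simp_all add: electric_part_def magnetic_part_def join_parts_def vec_eq_iff)

lemma join_parts_parts [simp]: "join_parts (electric_part v, magnetic_part v) = v"
  by (simp add: electric_part_def magnetic_part_def join_parts_def vec_eq_iff split: sum.split)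

lemma bounded_linear_parts:
  "bounded_linear electric_part" "bounded_linear magnetic_part" "bounded_linear join_parts"
  unfolding linear_conv_bounded_linear[symmetric]
  by (simp_all add: linear_iff electric_part_def magnetic_part_def join_parts_def vec_eq_iff split: sum.split)

lemma parts_smult:
  "electric_part (c *s v) = c *s electric_part v" "magnetic_part (c *s v) = c *s magnetic_part v"
  by (simp_all add: electric_part_def magnetic_part_def join_parts_def vec_eq_iff split: sum.split)

lemma block_matrix_mult:
  "block_matrix A B C D ** block_matrix A' B' C' D' =
     block_matrix (A ** A' + B ** C') (A ** B' + B ** D') (C ** A' + D ** C') (C ** B' + D ** D')"
  by (simp add: vec_eq_iff forall_2_plus_2 matrix_matrix_mult_def sum_UNIV_2_plus_2 sum_2
      block_matrix_def forall_2)

lemma block_matrix_add: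
  "block_matrix A B C D + block_matrix A' B' C' D' =
     block_matrix (A + A') (B + B') (C + C') (D + D')"
  by (simp add: vec_eq_iff block_matrix_def split: sum.split)

lemma mat_mult_block_matrix:
  "mat c ** block_matrix A B C D =
     block_matrix (mat c ** A) (mat c ** B) (mat c ** C) (mat c ** D)"
  by (simp add: mat_mult_matrix vec_eq_iff block_matrix_def split: sum.split)

lemma conj_transpose_block_matrix:
  "conj_transpose (block_matrix A B C D) =
     block_matrix (conj_transpose A) (conj_transpose C) (conj_transpose B) (conj_transpose D)"
  by (simp add: conj_transpose_def vec_eq_iff block_matrix_def split: sum.split)

lemma block_matrix_vector_mult:
  "block_matrix A B C D *v v = join_parts
     (A *v electric_part v + B *v magnetic_part v, C *v electric_part v + D *v magnetic_part v)"
  by (simp add: vec_eq_iff matrix_vector_mult_def sum_UNIV_2_plus_2 sum_2 block_matrix_def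
      join_parts_def electric_part_def magnetic_part_def split: sum.split)

lemma matrix_mult_zero [simp]:
  "(0 :: complex^'n^'m) ** (A :: complex^'k^'n) = 0" "(B :: complex^'n^'m) ** (0 :: complex^'k^'n) = 0"
  by (simp_all add: vec_eq_iff matrix_matrix_mult_def)

lemma mat_mult_mat: "mat a ** (mat b ** (A :: complex^'n^'m)) = mat (a * b) ** A"
  by (simp add: mat_mult_matrix vec_eq_iff mult.assoc)

lemma matrix_mult_mat: "(A :: complex^'n^'m) ** (mat c ** (B :: complex^'k^'n)) = mat c ** (A ** B)"
  unfolding mat_mult_matrix by (simp add: vec_eq_iff matrix_matrix_mult_def sum_distrib_left mult_ac)

lemmas matrix_mult_minus =
  bounded_bilinear.minus_left[OF bounded_bilinear_matrix_matrix_mult]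
  bounded_bilinear.minus_right[OF bounded_bilinear_matrix_matrix_mult]

lemma mat_minus: "mat (- c) ** (A :: complex^'n^'m) = - (mat c ** A)"
  by (simp add: mat_mult_matrix vec_eq_iff)

text \<open>With Q^-1 = -Q the system reads E' = -i\<omega> Q \<mu> H and H' = i\<omega> Q
  \<epsilon> E.\<close>

lemma system_matrix_block:
  "system_matrix \<epsilon> \<mu> \<omega> z =
     block_matrix 0 (mat (- (\<i> * \<omega>)) ** (rotQ ** \<mu> z)) (mat (\<i> * \<omega>) ** (rotQ ** \<epsilon> z)) 0"
  unfolding system_matrix_def calA_def matrix_inv_calQ mat_mult_block_matrix
    matrix_mul_assoc[symmetric] block_matrix_mult
  by (simp add: matrix_mult_mat[of rotQ] mat_mult_mat matrix_mult_minus mat_minus mult.commute)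

lemma system_matrix_mult:
  "system_matrix \<epsilon> \<mu> \<omega> z *v v =
     join_parts (- (\<i> * \<omega>) *s (rotQ *v (\<mu> z *v magnetic_part v)),
                 (\<i> * \<omega>) *s (rotQ *v (\<epsilon> z *v electric_part v)))"
  unfolding system_matrix_block block_matrix_vector_mult
  by (simp add: matrix_vector_mul_assoc[symmetric] mat_mult_vector)

lemma system_matrix_mult_parts:
  "electric_part (system_matrix \<epsilon> \<mu> \<omega> z *v v) = - (\<i> * \<omega>) *s (rotQ *v (\<mu> z *v magnetic_part v))"
  "magnetic_part (system_matrix \<epsilon> \<mu> \<omega> z *v v) = (\<i> * \<omega>) *s (rotQ *v (\<epsilon> z *v electric_part v))"
  by (simp_all add: system_matrix_mult)

text \<open>The frequency enters only through this factor; the continuity of the monodromy matrix in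
  \<omega> rests on it.\<close>

lemma system_matrix_scale: "system_matrix \<epsilon> \<mu> \<omega> z = mat \<omega> ** system_matrix \<epsilon> \<mu> 1 z"
  by (simp add: system_matrix_def matrix_mul_assoc[symmetric])

lemma norm_mat_mult: "norm (mat c ** (A :: complex^'n^'m)) = norm c * norm A"
proof -
  have "norm (\<chi> j. c * A $ i $ j) = norm c * norm (A $ i)" for i
    by (simp add: norm_vec_def norm_mult L2_set_right_distrib)
  then show ?thesis
    by (simp add: mat_mult_matrix norm_vec_def[of "\<chi> i. \<chi> j. c * A $ i $ j"] L2_set_right_distrib[symmetric])
       (simp add: norm_vec_def[of A])
qed

text \<open>The form \<open>v\<^sup>* J v = 2 Re (E\<^sup>* Q H)\<close> is the energy flux of \<open>v = (E, H)\<close>.\<close>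

definition flux_matrix :: "complex^(2+2)^(2+2)" where
  "flux_matrix = block_matrix 0 rotQ (- rotQ) 0"

text \<open>The energy density of the field: its form at v = (E, H) is E^* e E + H^* m H.\<close>

definition weight_matrix :: "complex^2^2 \<Rightarrow> complex^2^2 \<Rightarrow> complex^(2+2)^(2+2)" where
  "weight_matrix e m = block_matrix e 0 0 m"

lemma det_flux_matrix: "det flux_matrix \<noteq> 0"
proof -
  have "flux_matrix ** flux_matrix = mat 1"
    by (simp add: vec_eq_iff forall_2_plus_2 matrix_matrix_mult_def sum_UNIV_2_plus_2
        flux_matrix_def block_matrix_def rotQ_nth mat_def)
  then have "det flux_matrix * det flux_matrix = 1"
    by (metis det_I det_mul)
  then show ?thesis by auto
qed

lemma hermitian_entries:
  assumes "hermitian_pos_def (A :: complex^'n^'n)"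
  shows "cnj (A $ i $ j) = A $ j $ i"
proof -
  have "A = conj_transpose A" using assms by (simp add: hermitian_pos_def_def)
  then have "A $ j $ i = conj_transpose A $ j $ i" by simp
  then show ?thesis by (simp add: conj_transpose_def)
qed

text \<open>Poynting's theorem in matrix form. Q^2 = -I and Q^* Q = I give (cQA)^* Q - Q (cQA) = 2
  Re(c) A for Hermitian A. The two blocks have c = -i\<omega> and c = i\<omega>, and the opposite
  signs in J turn both results into 2 Im \<omega>.\<close>

lemma flux_identity:
  assumes e: "hermitian_pos_def (\<epsilon> z)" and m: "hermitian_pos_def (\<mu> z)"
  shows "conj_transpose (system_matrix \<epsilon> \<mu> \<omega> z) ** flux_matrix + flux_matrix ** system_matrix \<epsilon> \<mu> \<omega> z
      = mat (of_real (2 * Im \<omega>)) ** weight_matrix (\<epsilon> z) (\<mu> z)"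
proof -
  define X where "X c A = mat c ** (rotQ ** A)" for c and A :: "complex^2^2"
  have S: "system_matrix \<epsilon> \<mu> \<omega> z = block_matrix 0 (X (- (\<i> * \<omega>)) (\<mu> z)) (X (\<i> * \<omega>) (\<epsilon> z)) 0"
    by (simp add: system_matrix_block X_def)
  have XQ: "conj_transpose (X c A) ** rotQ - rotQ ** X c A = mat (cnj c + c) ** A"
    if "hermitian_pos_def A" for c A
    unfolding X_def mat_mult_matrix
    by (simp add: vec_eq_iff forall_2 matrix_matrix_mult_def sum_2 rotQ_nth
        conj_transpose_def hermitian_entries[OF that] algebra_simps)
  have c: "complex_of_real (2 * Im \<omega>) = \<i> * (cnj \<omega> - \<omega>)"
    by (simp add: complex_eq_iff)
  have E: "conj_transpose (X (\<i> * \<omega>) (\<epsilon> z)) ** (- rotQ) + rotQ ** X (\<i> * \<omega>) (\<epsilon> z)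
      = mat (of_real (2 * Im \<omega>)) ** \<epsilon> z"
  proof -
    have "conj_transpose (X (\<i> * \<omega>) (\<epsilon> z)) ** (- rotQ) + rotQ ** X (\<i> * \<omega>) (\<epsilon> z)
        = - (conj_transpose (X (\<i> * \<omega>) (\<epsilon> z)) ** rotQ - rotQ ** X (\<i> * \<omega>) (\<epsilon> z))"
      by (simp add: bounded_bilinear.minus_right[OF bounded_bilinear_matrix_matrix_mult])
    also have "\<dots> = mat (of_real (2 * Im \<omega>)) ** \<epsilon> z"
      unfolding XQ[OF e] c by (simp add: mat_mult_matrix vec_eq_iff algebra_simps)
    finally show ?thesis .
  qed
  have H: "conj_transpose (X (- (\<i> * \<omega>)) (\<mu> z)) ** rotQ + (- rotQ) ** X (- (\<i> * \<omega>)) (\<mu> z)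
      = mat (of_real (2 * Im \<omega>)) ** \<mu> z"
  proof -
    have "conj_transpose (X (- (\<i> * \<omega>)) (\<mu> z)) ** rotQ + (- rotQ) ** X (- (\<i> * \<omega>)) (\<mu> z)
        = mat (cnj (- (\<i> * \<omega>)) + (- (\<i> * \<omega>))) ** \<mu> z"
      using XQ[OF m, of "- (\<i> * \<omega>)"]
      by (simp add: bounded_bilinear.minus_left[OF bounded_bilinear_matrix_matrix_mult])
    also have "cnj (- (\<i> * \<omega>)) + (- (\<i> * \<omega>)) = of_real (2 * Im \<omega>)"
      by (simp add: complex_eq_iff)
    finally show ?thesis .
  qed
  have z: "conj_transpose 0 = (0 :: complex^2^2)" "mat x ** 0 = (0 :: complex^2^2)" for x
    by (simp_all add: conj_transpose_def vec_eq_iff matrix_matrix_mult_def)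
  show ?thesis
    unfolding S flux_matrix_def weight_matrix_def conj_transpose_block_matrix block_matrix_mult
      block_matrix_add mat_mult_block_matrix z
    using E H by (simp add: matrix_matrix_mult_def[of 0] matrix_matrix_mult_def[of _ 0] zero_vec_def[symmetric])
qed

definition herm :: "complex^'n \<Rightarrow> complex^'n \<Rightarrow> complex" where
  "herm u v = (\<Sum>i\<in>UNIV. cnj (u $ i) * v $ i)"

text \<open>Bilinearity is over the reals, so the conjugation in the first argument does no harm;
  this yields the product rule in the real variable z.\<close>

lemma bounded_bilinear_herm: "bounded_bilinear (herm :: complex^'n \<Rightarrow> complex^'n \<Rightarrow> complex)"
  unfolding bilinear_conv_bounded_bilinear[symmetric]
  by (simp add: bilinear_def linear_iff herm_def algebra_simps sum.distrib scaleR_sum_right)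

lemma bounded_linear_conj_transpose: "bounded_linear (conj_transpose :: complex^'n^'m \<Rightarrow> _)"
  unfolding linear_conv_bounded_linear[symmetric]
  by (simp add: linear_iff conj_transpose_def vec_eq_iff)

lemma conj_transpose_mult: "conj_transpose (A ** B) = conj_transpose B ** conj_transpose A"
  by (simp add: conj_transpose_def matrix_matrix_mult_def vec_eq_iff mult.commute)

lemma herm_matrix_left: "herm (A *v u) v = herm u (conj_transpose A *v v)"
proof -
  have "herm (A *v u) v = (\<Sum>i\<in>UNIV. \<Sum>j\<in>UNIV. cnj (A $ i $ j) * cnj (u $ j) * v $ i)"
    by (simp add: herm_def matrix_vector_mult_def sum_distrib_right)
  also have "\<dots> = (\<Sum>j\<in>UNIV. \<Sum>i\<in>UNIV. cnj (A $ i $ j) * cnj (u $ j) * v $ i)"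
    by (rule sum.swap)
  also have "\<dots> = herm u (conj_transpose A *v v)"
    by (simp add: herm_def matrix_vector_mult_def conj_transpose_def sum_distrib_left mult_ac)
  finally show ?thesis .
qed

lemma weight_matrix_pos:
  assumes e: "hermitian_pos_def e" and m: "hermitian_pos_def m" and v: "v \<noteq> 0"
  shows "0 < Re (herm v (weight_matrix e m *v v))"
proof -
  have "herm v (weight_matrix e m *v v) =
      (\<Sum>i\<in>UNIV. cnj (electric_part v $ i) * (e *v electric_part v) $ i)
      + (\<Sum>i\<in>UNIV. cnj (magnetic_part v $ i) * (m *v magnetic_part v) $ i)"
    by (simp add: herm_def weight_matrix_def matrix_vector_mult_def sum_UNIV_2_plus_2 sum_2
        block_matrix_def electric_part_def magnetic_part_def)
  moreover have nn: "0 \<le> Re (\<Sum>i\<in>UNIV. cnj (u $ i) * (A *v u) $ i)" if "hermitian_pos_def A" for A and u :: "complex^2"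
    using that by (cases "u = 0") (auto simp: hermitian_pos_def_def less_imp_le)
  moreover have "electric_part v \<noteq> 0 \<or> magnetic_part v \<noteq> 0"
    using v by (auto simp: electric_part_def magnetic_part_def vec_eq_iff forall_2_plus_2 forall_2)
  moreover have "0 < Re (\<Sum>i\<in>UNIV. cnj (u $ i) * (A *v u) $ i)" if "hermitian_pos_def A" "u \<noteq> 0" for A and u :: "complex^2"
    using that by (auto simp: hermitian_pos_def_def)
  ultimately show ?thesis
    using e m by (auto intro: add_pos_nonneg add_nonneg_pos)
qed

lemma weight_matrix_nonneg:
  assumes "hermitian_pos_def e" "hermitian_pos_def m"
  shows "0 \<le> Re (herm v (weight_matrix e m *v v))"
  using weight_matrix_pos[OF assms, of v] by (cases "v = 0") (auto simp: herm_def)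

lemma hermitian_pos_def_invertible:
  assumes "hermitian_pos_def (A :: complex^'n^'n)"
  shows "invertible A"
  unfolding invertible_det_nz
proof
  assume "det A = 0"
  then obtain v where "v \<noteq> 0" "A *v v = 0" by (rule det_eq_0_imp_kernel)
  then show False using assms by (auto simp: hermitian_pos_def_def)
qed

text \<open>Serves matrix-vector and matrix-matrix multiplication. The Lipschitz constant is the
  bound of \<open>S\<close> times that of \<open>h\<close>.\<close>

lemma piecewise_linear_ode_bilinear:
  fixes h :: "'m::real_normed_vector \<Rightarrow> 'a::euclidean_space \<Rightarrow> 'a"
  assumes h: "bounded_bilinear h" and S: "bounded (range S)"
    and "\<And>z. z \<in> R \<Longrightarrow> isCont S z" "\<And>a b. finite ({a..b} - R)"
  shows "\<exists>C. piecewise_linear_ode (\<lambda>z. h (S z)) R C"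
proof -
  obtain K where K: "K > 0" "\<And>a b. norm (h a b) \<le> norm a * norm b * K"
    using bounded_bilinear.pos_bounded[OF h] by blast
  obtain M where M: "M > 0" "\<And>z. norm (S z) \<le> M"
    using S by (auto simp: bounded_pos)
  have "norm (h (S z) x) \<le> M * K * norm x" for z x
  proof -
    have "norm (S z) * (norm x * K) \<le> M * (norm x * K)"
      using M(2)[of z] K(1) by (intro mult_right_mono) auto
    then show ?thesis using K(2)[of "S z" x] by (simp add: mult_ac)
  qed
  moreover have "linear (h (S z))" for z
    using bounded_bilinear.bounded_linear_right[OF h] by (simp add: bounded_linear.linear)
  moreover have "isCont (\<lambda>s. h (S s) (f s)) z" if "z \<in> R" "isCont f z" for f z
    using bounded_bilinear.continuous[OF h] assms(3) that by blast
  ultimately show ?thesis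
    using assms(4) M(1) K(1) by (intro exI[of _ "M * K"]) (simp add: piecewise_linear_ode_def)
qed

section \<open>The monodromy matrix\<close>

locale photonic_medium =
  fixes \<epsilon> \<mu> :: "real \<Rightarrow> complex^2^2"
  assumes photonic: "photonic_crystal \<epsilon> \<mu>"
begin

abbreviation S where "S \<equiv> system_matrix \<epsilon> \<mu>"

abbreviation regular :: "real set" where "regular \<equiv> {z. coeffs_cont \<epsilon> \<mu> z}"

text \<open>\<open>solves\<close> depends on \<open>L\<close> and \<open>R\<close> only, so
  solutions can be named for every \<omega> without fixing a Lipschitz constant.\<close>

abbreviation vector_solution :: "complex \<Rightarrow> (real \<Rightarrow> complex^(2+2)) \<Rightarrow> bool" where
  "vector_solution \<omega> \<equiv> piecewise_linear_ode.solves (\<lambda>z v. S \<omega> z *v v) regular"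

abbreviation matrix_solution :: "complex \<Rightarrow> (real \<Rightarrow> complex^(2+2)^(2+2)) \<Rightarrow> bool" where
  "matrix_solution \<omega> \<equiv> piecewise_linear_ode.solves (\<lambda>z T. S \<omega> z ** T) regular"

lemma finite_irregular: "finite ({a..b} - regular)"
proof -
  have "{a..b} - regular = {z \<in> {a..b}. \<not> isCont \<epsilon> z} \<union> {z \<in> {a..b}. \<not> isCont \<mu> z}"
    by (auto simp: coeffs_cont_def)
  then show ?thesis
    using photonic by (simp add: photonic_crystal_def piecewise_continuous_def)
qed

lemma regular_between: "a < b \<Longrightarrow> \<exists>z\<in>regular. a < z \<and> z < b"
proof -
  assume "a < b"
  then have "infinite ({a<..<b} - ({a..b} - regular))"
    by (intro Diff_infinite_finite finite_irregular infinite_Ioo)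
  then have "{a<..<b} - ({a..b} - regular) \<noteq> {}" by (metis finite.emptyI)
  then obtain z where "z \<in> {a<..<b} - ({a..b} - regular)" by blast
  then show ?thesis by auto
qed

lemma system_matrix_cont_bounded:
  "bounded (range (S \<omega>))" "z \<in> regular \<Longrightarrow> isCont (S \<omega>) z"
proof -
  \<comment> \<open>For fixed \<omega> the system matrix is a linear image of the pair (\<epsilon>,
    \<mu>), so boundedness and continuity carry over.\<close>
  define F where "F = (\<lambda>p :: (complex^2^2) \<times> (complex^2^2).
    block_matrix 0 (mat (- (\<i> * \<omega>)) ** (rotQ ** snd p)) (mat (\<i> * \<omega>) ** (rotQ ** fst p)) 0)"
  have "linear F"
    unfolding F_def mat_mult_matrix
    by (simp add: linear_iff vec_eq_iff block_matrix_def matrix_matrix_mult_def sum_2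
        algebra_simps split: sum.split)
  then have F: "bounded_linear F" by (simp add: linear_conv_bounded_linear)
  have S: "S \<omega> = (\<lambda>z. F (\<epsilon> z, \<mu> z))"
    by (simp add: fun_eq_iff system_matrix_block F_def)
  have "bounded (range \<epsilon> \<times> range \<mu>)"
    using photonic by (intro bounded_Times) (auto simp: photonic_crystal_def)
  then have "bounded (range (\<lambda>z. (\<epsilon> z, \<mu> z)))"
    by (rule bounded_subset) auto
  then have "bounded (F ` range (\<lambda>z. (\<epsilon> z, \<mu> z)))"
    by (rule bounded_linear_image[OF _ F])
  then show "bounded (range (S \<omega>))" by (simp add: S image_image)
  show "isCont (S \<omega>) z" if "z \<in> regular"
    unfolding S using that
    by (intro bounded_linear.isCont[OF F] continuous_Pair) (auto simp: coeffs_cont_def)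
qed

lemma vector_ode: "\<exists>C. piecewise_linear_ode (\<lambda>z v. S \<omega> z *v v) regular C"
  by (rule piecewise_linear_ode_bilinear[OF bounded_bilinear_matrix_vector_mult])
    (auto intro: system_matrix_cont_bounded finite_irregular)

lemma matrix_ode: "\<exists>C. piecewise_linear_ode (\<lambda>z (T :: complex^(2+2)^(2+2)). S \<omega> z ** T) regular C"
  by (rule piecewise_linear_ode_bilinear[OF bounded_bilinear_matrix_matrix_mult])
    (auto intro: system_matrix_cont_bounded finite_irregular)

lemma vector_solution_iff:
  "vector_solution \<omega> \<Phi> \<longleftrightarrow> continuous_on UNIV \<Phi> \<and>
     (\<forall>z. coeffs_cont \<epsilon> \<mu> z \<longrightarrow> (\<Phi> has_vector_derivative (S \<omega> z *v \<Phi> z)) (at z))"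
  using vector_ode piecewise_linear_ode.solves_def by fastforce

lemma matrix_solution_iff:
  "matrix_solution \<omega> T \<longleftrightarrow> continuous_on UNIV T \<and>
     (\<forall>z. coeffs_cont \<epsilon> \<mu> z \<longrightarrow> (T has_vector_derivative (S \<omega> z ** T z)) (at z))"
  using matrix_ode piecewise_linear_ode.solves_def by fastforce

lemma vector_solution_unique:
  "vector_solution \<omega> \<Phi> \<Longrightarrow> vector_solution \<omega> \<Psi> \<Longrightarrow> \<Phi> z0 = \<Psi> z0 \<Longrightarrow> \<Phi> z = \<Psi> z"
  by (rule exE[OF vector_ode[of \<omega>]]) (rule piecewise_linear_ode.solves_unique)

lemma vector_solution_0: "vector_solution \<omega> \<Phi> \<Longrightarrow> \<Phi> z0 = 0 \<Longrightarrow> \<Phi> z = 0"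
  by (rule exE[OF vector_ode[of \<omega>]]) (rule piecewise_linear_ode.solves_0)

definition T :: "complex \<Rightarrow> real \<Rightarrow> complex^(2+2)^(2+2)" where
  "T \<omega> z = propagator \<epsilon> \<mu> \<omega> z 0"

text \<open>\<open>propagator\<close> is a definite description; the existence and uniqueness of
  matrix solutions turn it into an actual solution.\<close>

lemma T: "matrix_solution \<omega> (T \<omega>)" "T \<omega> 0 = mat 1"
proof -
  obtain C where ode: "piecewise_linear_ode (\<lambda>z (T :: complex^(2+2)^(2+2)). S \<omega> z ** T) regular C"
    using matrix_ode by blast
  have "\<exists>!U. matrix_solution \<omega> U \<and> U 0 = mat 1"
    using piecewise_linear_ode.solves_exists[OF ode, of "mat 1"] piecewise_linear_ode.solves_unique[OF ode]
    by (intro ex_ex1I ext) metis+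
  then have "matrix_solution \<omega> (THE U. matrix_solution \<omega> U \<and> U 0 = mat 1) \<and>
      (THE U. matrix_solution \<omega> U \<and> U 0 = mat 1) 0 = mat 1"
    by (rule theI')
  moreover have "T \<omega> = (THE U. matrix_solution \<omega> U \<and> U 0 = mat 1)"
    unfolding T_def propagator_def matrix_solution_iff by (simp add: conj_ac)
  ultimately show "matrix_solution \<omega> (T \<omega>)" "T \<omega> 0 = mat 1" by simp_all
qed

lemma T_deriv:
  "continuous_on UNIV (T \<omega>)"
  "z \<in> regular \<Longrightarrow> (T \<omega> has_vector_derivative (S \<omega> z ** T \<omega> z)) (at z)"
  using T(1) by (auto simp: matrix_solution_iff)

lemma monodromy_T: "monodromy \<epsilon> \<mu> \<omega> = T \<omega> 1"
  by (simp add: monodromy_def T_def)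

lemma vector_solution_T: "vector_solution \<omega> (\<lambda>z. T \<omega> z *v v)"
proof -
  have b: "bounded_linear (\<lambda>A :: complex^(2+2)^(2+2). A *v v)"
    by (rule bounded_bilinear.bounded_linear_left[OF bounded_bilinear_matrix_vector_mult])
  show ?thesis
    using T_deriv bounded_linear.has_vector_derivative[OF b] bounded_linear.continuous_on[OF b]
    unfolding vector_solution_iff matrix_vector_mul_assoc by blast
qed

lemma vector_solution_eq_T: "vector_solution \<omega> \<Phi> \<Longrightarrow> \<Phi> z = T \<omega> z *v \<Phi> 0"
  using vector_solution_unique[OF _ vector_solution_T, of \<omega> \<Phi> 0 "\<Phi> 0" z] by (simp add: T(2))

section \<open>Floquet theory\<close>

lemma periodic: "\<epsilon> (z + 1) = \<epsilon> z" "\<mu> (z + 1) = \<mu> z"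
  using photonic by (simp_all add: photonic_crystal_def)

lemma isCont_periodic_shift:
  fixes f :: "real \<Rightarrow> 'a::topological_space"
  assumes "\<And>z. f (z + 1) = f z" "isCont f z"
  shows "isCont f (z + 1)"
proof -
  have "isCont (\<lambda>x. f (x - 1)) (z + 1)"
    by (rule continuous_at_compose[of "z + 1" "\<lambda>x. x - 1" f, unfolded o_def]) (auto intro: assms(2) continuous_intros)
  moreover have "f (x - 1) = f x" for x using assms(1)[of "x - 1"] by simp
  ultimately show ?thesis by simp
qed

lemma vector_solution_shift:
  assumes "vector_solution \<omega> \<Phi>"
  shows "vector_solution \<omega> (\<lambda>z. \<Phi> (z + 1))"
  unfolding vector_solution_iff
proof (intro conjI allI impI)
  have c: "continuous_on UNIV \<Phi>"
    and d: "\<And>z. coeffs_cont \<epsilon> \<mu> z \<Longrightarrow> (\<Phi> has_vector_derivative (S \<omega> z *v \<Phi> z)) (at z)"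
    using assms by (auto simp: vector_solution_iff)
  show "continuous_on UNIV (\<lambda>z. \<Phi> (z + 1))"
    by (rule continuous_on_compose2[OF c]) (auto intro!: continuous_intros)
  fix z assume "coeffs_cont \<epsilon> \<mu> z"
  then have z: "coeffs_cont \<epsilon> \<mu> (z + 1)"
    by (auto simp: coeffs_cont_def intro: isCont_periodic_shift periodic)
  have m: "((\<lambda>z. z + 1) has_vector_derivative 1) (at z)"
    by (auto intro!: derivative_eq_intros)
  have "S \<omega> (z + 1) = S \<omega> z" by (simp add: system_matrix_block periodic)
  then show "((\<lambda>z. \<Phi> (z + 1)) has_vector_derivative S \<omega> z *v \<Phi> (z + 1)) (at z)"
    using vector_diff_chain_at[OF m d[OF z]] by (simp add: o_def)
qed

text \<open>Translates by a period and scalar multiples of solutions are solutions. By uniqueness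
  the Bloch condition holds everywhere once it holds at z = 0, where it says that the initial value
  is an eigenvector of the monodromy matrix.\<close>

lemma eigenfrequency_iff:
  "eigenfrequency \<epsilon> \<mu> k \<omega> \<longleftrightarrow> det (mat (exp (\<i> * of_real k)) - monodromy \<epsilon> \<mu> \<omega>) = 0"
proof
  let ?l = "exp (\<i> * of_real k)"
  have m: "(mat ?l - monodromy \<epsilon> \<mu> \<omega>) *v v = ?l *s v - T \<omega> 1 *v v" for v
    by (simp add: matrix_vector_mult_diff_rdistrib mat_mult_vector monodromy_T)
  {
    assume "eigenfrequency \<epsilon> \<mu> k \<omega>"
    then obtain \<Phi> z where \<Phi>: "vector_solution \<omega> \<Phi>" "\<Phi> z \<noteq> 0" "\<And>z. \<Phi> (z + 1) = ?l *s \<Phi> z"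
      by (auto simp: eigenfrequency_def vector_solution_iff)
    have "T \<omega> 1 *v \<Phi> 0 = ?l *s \<Phi> 0"
      using \<Phi>(3)[of 0] vector_solution_eq_T[OF \<Phi>(1), of 1] by simp
    moreover have "\<Phi> 0 \<noteq> 0" using vector_solution_0[OF \<Phi>(1)] \<Phi>(2) by blast
    ultimately show "det (mat ?l - monodromy \<epsilon> \<mu> \<omega>) = 0"
      using kernel_imp_det_eq_0[of "\<Phi> 0"] m by simp
  next
    assume "det (mat ?l - monodromy \<epsilon> \<mu> \<omega>) = 0"
    then obtain v where v: "v \<noteq> 0" "(mat ?l - monodromy \<epsilon> \<mu> \<omega>) *v v = 0"
      by (rule det_eq_0_imp_kernel)
    define \<Phi> where "\<Phi> z = T \<omega> z *v v" for z
    have s: "vector_solution \<omega> \<Phi>" unfolding \<Phi>_def by (rule vector_solution_T)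
    have 1: "\<Phi> 1 = ?l *s \<Phi> 0" "\<Phi> 0 = v" using v(2) m by (simp_all add: \<Phi>_def T(2))
    have "(\<lambda>z. ?l *s \<Phi> z) = (\<lambda>z. T \<omega> z *v (?l *s v))"
      by (simp add: \<Phi>_def vector_scalar_commute)
    then have "vector_solution \<omega> (\<lambda>z. ?l *s \<Phi> z)" by (simp add: vector_solution_T)
    then have "\<Phi> (z + 1) = ?l *s \<Phi> z" for z
      using vector_solution_unique[OF vector_solution_shift[OF s], of "\<lambda>z. ?l *s \<Phi> z" 0] 1 by simp
    then show "eigenfrequency \<epsilon> \<mu> k \<omega>"
      unfolding eigenfrequency_def using s 1(2) v(1)
      by (intro exI[of _ \<Phi>]) (auto simp: vector_solution_iff)
  }
qed

text \<open>\<open>Arg\<close> supplies k in [-pi, pi] for every unimodular number. This description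
  by eigenvalues on the unit circle is what closedness of \<Gamma> and local constancy of the index
  are proved from.\<close>

lemma dispersion_union_iff:
  "\<omega> \<in> dispersion_union \<epsilon> \<mu> \<longleftrightarrow> (\<exists>l. norm l = 1 \<and> det (mat l - monodromy \<epsilon> \<mu> \<omega>) = 0)"
proof
  assume "\<omega> \<in> dispersion_union \<epsilon> \<mu>"
  then show "\<exists>l. norm l = 1 \<and> det (mat l - monodromy \<epsilon> \<mu> \<omega>) = 0"
    unfolding dispersion_union_def eigenfrequency_iff using norm_exp_i_times by blast
next
  assume "\<exists>l. norm l = 1 \<and> det (mat l - monodromy \<epsilon> \<mu> \<omega>) = 0"
  then obtain l where l: "norm l = 1" "det (mat l - monodromy \<epsilon> \<mu> \<omega>) = 0" by blast
  have "l \<noteq> 0" using l(1) by auto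
  then have l_eq: "l = exp (\<i> * of_real (Arg l))"
    using Arg_eq[of l] l(1) by simp
  moreover have "Arg l \<in> {-pi..pi}" using mpi_less_Arg[of l] Arg_le_pi[of l] by simp
  moreover have "det (mat (exp (\<i> * of_real (Arg l))) - monodromy \<epsilon> \<mu> \<omega>) = 0"
    using l(2) by (simp flip: l_eq)
  ultimately show "\<omega> \<in> dispersion_union \<epsilon> \<mu>"
    unfolding dispersion_union_def eigenfrequency_iff by blast
qed

section \<open>Dependence on the frequency\<close>

text \<open>T_w - T_\<omega> vanishes at 0 and solves the equation for w with the additional source
  (w - \<omega>) S_1 T_\<omega>. Gronwall with \<delta> = \<open>d w\<close> bounds it by a multiple
  of |w - \<omega>|.\<close>

lemma isCont_monodromy: "isCont (monodromy \<epsilon> \<mu>) \<omega>"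
proof -
  obtain K where K: "K > 0" "\<And>(A :: complex^(2+2)^(2+2)) (B :: complex^(2+2)^(2+2)). norm (A ** B) \<le> norm A * norm B * K"
    using bounded_bilinear.pos_bounded[OF bounded_bilinear_matrix_matrix_mult] by blast
  obtain c where c: "c > 0" "\<And>z. norm (S 1 z) \<le> c"
    using system_matrix_cont_bounded(1)[of 1] by (auto simp: bounded_pos)
  have S: "norm ((mat w :: complex^(2+2)^(2+2)) ** S 1 z ** B) \<le> norm w * (c * K * norm B)" for w z and B :: "complex^(2+2)^(2+2)"
  proof -
    have "norm ((mat w :: complex^(2+2)^(2+2)) ** S 1 z ** B) = norm w * norm (S 1 z ** B)"
      by (simp add: norm_mat_mult matrix_mul_assoc[symmetric])
    also have "norm (S 1 z ** B) \<le> c * K * norm B"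
    proof -
      have "norm (S 1 z) * (norm B * K) \<le> c * (norm B * K)"
        using c(2)[of z] K(1) by (intro mult_right_mono) auto
      then show ?thesis using K(2)[of "S 1 z" B] by (simp add: mult_ac)
    qed
    finally show ?thesis by (simp add: mult_left_mono)
  qed
  have "bounded (T \<omega> ` {0..1})"
    by (intro compact_imp_bounded compact_continuous_image continuous_on_subset[OF T_deriv(1)]) auto
  then obtain B where B: "B > 0" "\<And>z. z \<in> {0..1} \<Longrightarrow> norm (T \<omega> z) \<le> B"
    by (auto simp: bounded_pos)
  \<comment> \<open>A growth rate valid for all w with |w - \<omega>| < 1, which makes the Gronwall
    factor independent of w.\<close>
  define k where "k = (norm \<omega> + 1) * (c * K)"
  define d where "d w = norm (w - \<omega>) * (c * K * B)" for w
  have k: "k > 0" using c(1) K(1) by (simp add: k_def add_nonneg_pos)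
  have est: "(norm (T w 1 - T \<omega> 1))\<^sup>2 \<le> (d w)\<^sup>2 * (exp ((2 * k + 1) * (1 - 0)) - 1)" if w: "norm (w - \<omega>) < 1" for w
  proof (rule gronwall_piecewise[OF _ finite_irregular[of 0 1], where u = "\<lambda>z. T w z - T \<omega> z"])
    show "continuous_on {0..1} (\<lambda>z. T w z - T \<omega> z)"
      by (intro continuous_intros continuous_on_subset[OF T_deriv(1)]) auto
    fix z :: real assume z: "z \<in> {0<..<1} - ({0..1} - regular)"
    have nw: "norm w \<le> norm \<omega> + 1" using w norm_triangle_sub[of w \<omega>] by simp
    have "S w z ** T w z - S \<omega> z ** T \<omega> z
        = (mat w :: complex^(2+2)^(2+2)) ** S 1 z ** (T w z - T \<omega> z) + (mat (w - \<omega>) :: complex^(2+2)^(2+2)) ** S 1 z ** T \<omega> z"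
    proof -
      have "mat (w - \<omega>) = mat w - (mat \<omega> :: complex^(2+2)^(2+2))" by (simp add: mat_def vec_eq_iff)
      then show ?thesis
        using system_matrix_scale[of \<epsilon> \<mu> w z] system_matrix_scale[of \<epsilon> \<mu> \<omega> z]
        by (simp add: bounded_bilinear.diff_left[OF bounded_bilinear_matrix_matrix_mult]
            bounded_bilinear.diff_right[OF bounded_bilinear_matrix_matrix_mult])
    qed
    also have "norm \<dots> \<le> norm w * (c * K * norm (T w z - T \<omega> z)) + norm (w - \<omega>) * (c * K * norm (T \<omega> z))"
      by (intro order_trans[OF norm_triangle_ineq] add_mono S)
    also have "\<dots> \<le> k * norm (T w z - T \<omega> z) + d w"
    proof (rule add_mono)
      show "norm w * (c * K * norm (T w z - T \<omega> z)) \<le> k * norm (T w z - T \<omega> z)"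
        unfolding k_def using mult_right_mono[OF nw, of "c * K * norm (T w z - T \<omega> z)"] c(1) K(1)
        by (simp add: mult.assoc)
      show "norm (w - \<omega>) * (c * K * norm (T \<omega> z)) \<le> d w"
        unfolding d_def using B(2)[of z] z c(1) K(1) by (intro mult_left_mono) auto
    qed
    finally show "\<exists>e. ((\<lambda>z. T w z - T \<omega> z) has_vector_derivative e) (at z) \<and>
        norm e \<le> k * norm (T w z - T \<omega> z) + d w"
      using z by (intro exI[of _ "S w z ** T w z - S \<omega> z ** T \<omega> z"])
        (auto intro!: has_vector_derivative_diff T_deriv(2))
  qed (use k in \<open>auto simp: T(2)\<close>)
  have "((\<lambda>w. (norm (T w 1 - T \<omega> 1))\<^sup>2) \<longlongrightarrow> 0) (at \<omega>)"
  proof (rule Lim_null_comparison)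
    show "\<forall>\<^sub>F w in at \<omega>. norm ((norm (T w 1 - T \<omega> 1))\<^sup>2) \<le> (d w)\<^sup>2 * (exp ((2 * k + 1) * (1 - 0)) - 1)"
      unfolding eventually_at using est by (intro exI[of _ 1]) (auto simp: dist_norm)
    have "((\<lambda>w. (d w)\<^sup>2 * (exp ((2 * k + 1) * (1 - 0)) - 1)) \<longlongrightarrow> (d \<omega>)\<^sup>2 * (exp ((2 * k + 1) * (1 - 0)) - 1)) (at \<omega>)"
      unfolding d_def by (intro tendsto_intros)
    then show "((\<lambda>w. (d w)\<^sup>2 * (exp ((2 * k + 1) * (1 - 0)) - 1)) \<longlongrightarrow> 0) (at \<omega>)"
      by (simp add: d_def)
  qed
  then have "((\<lambda>w. sqrt ((norm (T w 1 - T \<omega> 1))\<^sup>2)) \<longlongrightarrow> sqrt 0) (at \<omega>)"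
    by (rule tendsto_real_sqrt)
  then have "((\<lambda>w. T w 1 - T \<omega> 1) \<longlongrightarrow> 0) (at \<omega>)"
    by (simp add: tendsto_norm_zero_iff)
  then show ?thesis
    unfolding isCont_def monodromy_T[abs_def] by (rule Lim_null[THEN iffD2])
qed

text \<open>Unimodular eigenvalues along a convergent sequence of frequencies accumulate, by
  compactness of the circle, at a unimodular eigenvalue for the limit frequency.\<close>

lemma open_Compl_dispersion_union: "open (UNIV - dispersion_union \<epsilon> \<mu>)"
proof -
  have "closed (dispersion_union \<epsilon> \<mu>)"
    unfolding closed_sequential_limits
  proof (intro allI impI, elim conjE)
    fix x w assume x: "\<forall>n. x n \<in> dispersion_union \<epsilon> \<mu>" and w: "x \<longlonglongrightarrow> w"
    obtain l where l: "\<And>n. norm (l n) = 1" "\<And>n. det (mat (l n) - monodromy \<epsilon> \<mu> (x n)) = 0"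
      using x unfolding dispersion_union_iff by metis
    have "bounded (range l)" using l(1) by (auto simp: bounded_iff intro!: exI[of _ 1])
    then obtain m s where s: "strict_mono s" "(l \<circ> s) \<longlonglongrightarrow> m"
      by (blast dest: bounded_imp_convergent_subsequence)
    have "(\<lambda>n. monodromy \<epsilon> \<mu> (x (s n))) \<longlonglongrightarrow> monodromy \<epsilon> \<mu> w"
      using LIMSEQ_subseq_LIMSEQ[OF w s(1)] by (intro isCont_tendsto_compose[OF isCont_monodromy]) (simp add: o_def)
    moreover have "(\<lambda>n. mat (l (s n)) :: complex^(2+2)^(2+2)) \<longlonglongrightarrow> mat m"
    proof -
      have "bounded_linear (mat :: complex \<Rightarrow> complex^(2+2)^(2+2))"
        unfolding linear_conv_bounded_linear[symmetric] by (simp add: linear_iff mat_def vec_eq_iff)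
      then show ?thesis using s(2) by (auto simp: o_def dest: bounded_linear.tendsto)
    qed
    ultimately have "(\<lambda>n. det (mat (l (s n)) - monodromy \<epsilon> \<mu> (x (s n)))) \<longlonglongrightarrow> det (mat m - monodromy \<epsilon> \<mu> w)"
      by (intro tendsto_det tendsto_diff)
    then have "det (mat m - monodromy \<epsilon> \<mu> w) = 0"
      by (simp add: l(2) LIMSEQ_const_iff)
    moreover have "norm m = 1"
      using tendsto_norm[OF s(2)] by (simp add: l(1) o_def LIMSEQ_const_iff)
    ultimately show "w \<in> dispersion_union \<epsilon> \<mu>"
      by (auto simp: dispersion_union_iff)
  qed
  then show ?thesis by (simp add: open_Diff)
qed

text \<open>A failure of local constancy at \<open>a\<close> gives a sequence tending to
  \<open>a\<close> on which the index always differs from its value at \<open>a\<close>. A single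
  term with equal counts refutes this, which is why \<open>eigenvalue_counts_limit\<close> asserts
  just one.\<close>

lemma gap_index_constant:
  assumes "connected D" "D \<inter> dispersion_union \<epsilon> \<mu> = {}" "u \<in> D" "w \<in> D"
  shows "gap_index \<epsilon> \<mu> u = gap_index \<epsilon> \<mu> w"
proof -
  have "\<forall>\<^sub>F x in at a within D. gap_index \<epsilon> \<mu> a = gap_index \<epsilon> \<mu> x" if a: "a \<in> D" for a
  proof (rule ccontr)
    assume "\<not> ?thesis"
    then have neg: "\<not> (\<exists>d>0. \<forall>x\<in>D. x \<noteq> a \<and> dist x a < d \<longrightarrow> gap_index \<epsilon> \<mu> a = gap_index \<epsilon> \<mu> x)"
      by (simp only: eventually_at not_False_eq_True)
    have "\<exists>x. dist x a < inverse (real (Suc n)) \<and> gap_index \<epsilon> \<mu> x \<noteq> gap_index \<epsilon> \<mu> a" for n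
    proof (rule ccontr)
      assume no: "\<not> ?thesis"
      have "gap_index \<epsilon> \<mu> a = gap_index \<epsilon> \<mu> y" if "dist y a < inverse (real (Suc n))" for y
        using no that by metis
      moreover have "0 < inverse (real (Suc n))" by simp
      ultimately show False using neg by blast
    qed
    then obtain x where x: "\<And>n. dist (x n) a < inverse (real (Suc n))"
        "\<And>n. gap_index \<epsilon> \<mu> (x n) \<noteq> gap_index \<epsilon> \<mu> a"
      using choice[where Q = "\<lambda>n x. dist x a < inverse (real (Suc n)) \<and> gap_index \<epsilon> \<mu> x \<noteq> gap_index \<epsilon> \<mu> a"] by blast
    have "x \<longlonglongrightarrow> a"
      by (rule metric_tendsto_imp_tendsto[OF LIMSEQ_inverse_real_of_nat])
        (use x(1) in \<open>auto simp: less_imp_le intro!: always_eventually\<close>)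
    then have "(\<lambda>n. monodromy \<epsilon> \<mu> (x n)) \<longlonglongrightarrow> monodromy \<epsilon> \<mu> a"
      by (rule isCont_tendsto_compose[OF isCont_monodromy])
    moreover have "a \<notin> dispersion_union \<epsilon> \<mu>" using a assms(2) by blast
    ultimately obtain n where
      "size {# l \<in># eigenvalues (monodromy \<epsilon> \<mu> (x n)). norm l < 1 #}
        = size {# l \<in># eigenvalues (monodromy \<epsilon> \<mu> a). norm l < 1 #}"
      "size {# l \<in># eigenvalues (monodromy \<epsilon> \<mu> (x n)). norm l > 1 #}
        = size {# l \<in># eigenvalues (monodromy \<epsilon> \<mu> a). norm l > 1 #}"
      using eigenvalue_counts_limit[of "\<lambda>n. monodromy \<epsilon> \<mu> (x n)" "monodromy \<epsilon> \<mu> a"]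
      unfolding dispersion_union_iff by blast
    then have "gap_index \<epsilon> \<mu> (x n) = gap_index \<epsilon> \<mu> a" by (simp add: gap_index_def)
    with x(2) show False by blast
  qed
  then show ?thesis
    using connected_local_const[OF assms(1,3,4), of "gap_index \<epsilon> \<mu>"] by blast
qed

end

section \<open>Hermitian media\<close>

locale hermitian_medium = photonic_medium +
  assumes pos_def: "hermitian_pos_def (\<epsilon> z)" "hermitian_pos_def (\<mu> z)"
begin

definition flux :: "complex^(2+2) \<Rightarrow> real" where
  "flux v = Re (herm v (flux_matrix *v v))"

lemma flux_smult: "norm c = 1 \<Longrightarrow> flux (c *s v) = flux v"
proof -
  assume c: "norm c = 1"
  have "herm (c *s v) (flux_matrix *v (c *s v)) = (cnj c * c) * herm v (flux_matrix *v v)"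
    by (simp add: herm_def vector_scalar_commute sum_distrib_left mult_ac)
  also have "cnj c * c = 1"
    using c complex_norm_square[of c] by (simp add: mult.commute)
  finally show ?thesis by (simp add: flux_def)
qed

text \<open>The local energy balance: the product rule produces \<Phi>^* (S^* J + J S) \<Phi>, which
  \<open>flux_identity\<close> evaluates.\<close>

lemma flux_deriv:
  assumes "(\<Phi> has_vector_derivative (S \<omega> z *v \<Phi> z)) (at z)"
  shows "((\<lambda>s. flux (\<Phi> s)) has_vector_derivative
      2 * Im \<omega> * Re (herm (\<Phi> z) (weight_matrix (\<epsilon> z) (\<mu> z) *v \<Phi> z))) (at z)"
proof -
  let ?J = flux_matrix and ?W = "weight_matrix (\<epsilon> z) (\<mu> z)" and ?x = "\<Phi> z"
  have "((\<lambda>s. ?J *v \<Phi> s) has_vector_derivative (?J *v (S \<omega> z *v ?x))) (at z)"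
    by (rule bounded_linear.has_vector_derivative[OF
          bounded_bilinear.bounded_linear_right[OF bounded_bilinear_matrix_vector_mult] assms])
  then have "((\<lambda>s. herm (\<Phi> s) (?J *v \<Phi> s)) has_vector_derivative
      (herm ?x (?J *v (S \<omega> z *v ?x)) + herm (S \<omega> z *v ?x) (?J *v ?x))) (at z)"
    by (rule bounded_bilinear.has_vector_derivative[OF bounded_bilinear_herm assms])
  also have "herm ?x (?J *v (S \<omega> z *v ?x)) + herm (S \<omega> z *v ?x) (?J *v ?x)
      = herm ?x ((conj_transpose (S \<omega> z) ** ?J + ?J ** S \<omega> z) *v ?x)"
    by (simp add: herm_matrix_left matrix_vector_mul_assoc[symmetric] matrix_vector_mult_add_rdistrib
        bounded_bilinear.add_right[OF bounded_bilinear_herm])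
  also have "\<dots> = herm ?x (of_real (2 * Im \<omega>) *s (?W *v ?x))"
    unfolding flux_identity[where \<epsilon> = \<epsilon> and \<mu> = \<mu>, OF pos_def]
    by (simp only: matrix_vector_mul_assoc[symmetric] mat_mult_vector)
  also have "\<dots> = of_real (2 * Im \<omega>) * herm ?x (?W *v ?x)"
    by (simp add: herm_def sum_distrib_left mult_ac)
  finally have "((\<lambda>s. Re (herm (\<Phi> s) (?J *v \<Phi> s))) has_vector_derivative
      Re (of_real (2 * Im \<omega>) * herm ?x (?W *v ?x))) (at z)"
    by (rule bounded_linear.has_vector_derivative[OF bounded_linear_Re])
  then show ?thesis by (simp add: flux_def)
qed

text \<open>Quasi-periodicity makes the flux periodic, whereas \<open>Im \<omega>\<close> times the flux is nondecreasing,
  strictly so wherever \<open>\<Phi> \<noteq> 0\<close>.\<close>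

lemma eigenfrequency_real:
  assumes "eigenfrequency \<epsilon> \<mu> k \<omega>"
  shows "Im \<omega> = 0"
proof (rule ccontr)
  assume Im: "Im \<omega> \<noteq> 0"
  obtain \<Phi> x where \<Phi>: "vector_solution \<omega> \<Phi>" "\<Phi> x \<noteq> 0" "\<And>z. \<Phi> (z + 1) = exp (\<i> * of_real k) *s \<Phi> z"
    using assms by (auto simp: eigenfrequency_def vector_solution_iff)
  define w where "w z = Re (herm (\<Phi> z) (weight_matrix (\<epsilon> z) (\<mu> z) *v \<Phi> z))" for z
  \<comment> \<open>The factor \<open>Im \<omega>\<close> makes the derivative 2 (Im \<omega>)^2
    times the energy density, non-negative in either half plane.\<close>
  define g where "g z = Im \<omega> * flux (\<Phi> z)" for z
  have g': "(g has_vector_derivative 2 * (Im \<omega>)\<^sup>2 * w z) (at z)" if "z \<in> regular" for z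
  proof -
    have "((\<lambda>s. flux (\<Phi> s)) has_vector_derivative 2 * Im \<omega> * w z) (at z)"
      unfolding w_def using \<Phi>(1) that by (intro flux_deriv) (auto simp: vector_solution_iff)
    then have "((\<lambda>s. Im \<omega> * flux (\<Phi> s)) has_vector_derivative Im \<omega> * (2 * Im \<omega> * w z)) (at z)"
      by (rule bounded_linear.has_vector_derivative[OF bounded_linear_mult_right])
    then show ?thesis by (simp add: g_def[abs_def] power2_eq_square mult_ac)
  qed
  have cg: "continuous_on A g" for A
  proof -
    have c: "continuous_on A \<Phi>"
      using \<Phi>(1) continuous_on_subset by (auto simp: vector_solution_iff)
    show ?thesis
      unfolding g_def flux_def
      by (intro continuous_intros bounded_bilinear.continuous_on[OF bounded_bilinear_herm]
          bounded_linear.continuous_on[OF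
            bounded_bilinear.bounded_linear_right[OF bounded_bilinear_matrix_vector_mult]] c)
  qed
  have mono: "g a \<le> g b" if "a \<le> b" for a b
  proof (rule mono_piecewise_derivative[OF that finite_irregular cg])
    fix z assume "z \<in> {a<..<b} - ({a..b} - regular)"
    then have "z \<in> regular" by auto
    moreover have "0 \<le> 2 * (Im \<omega>)\<^sup>2 * w z"
      by (simp add: w_def weight_matrix_nonneg pos_def)
    ultimately show "\<exists>d\<ge>0. (g has_vector_derivative d) (at z)" using g' by blast
  qed
  have "g 1 = g 0"
    using \<Phi>(3)[of 0] by (simp add: g_def flux_smult)
  then have const: "g t = g 0" if "0 \<le> t" "t \<le> 1" for t
    using mono[OF that(1)] mono[OF that(2)] by simp
  obtain z where z: "z \<in> regular" "0 < z" "z < 1"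
    using regular_between[of 0 1] by auto
  \<comment> \<open>Being nondecreasing with equal values at 0 and 1, \<open>g\<close> is constant
    in between; its derivative at a regular point then vanishes, against the positive energy
    density.\<close>
  have "((\<lambda>_. g 0) has_vector_derivative 2 * (Im \<omega>)\<^sup>2 * w z) (at z)"
    by (rule has_vector_derivative_transform_within_open[OF g'[OF z(1)], where S = "{0<..<1}"])
      (auto simp: z intro: const)
  then have "2 * (Im \<omega>)\<^sup>2 * w z = 0"
    by (rule vector_derivative_unique_at[OF _ has_vector_derivative_const])
  moreover have "\<Phi> z \<noteq> 0"
    using vector_solution_0[OF \<Phi>(1)] \<Phi>(2) by blast
  then have "0 < w z"
    unfolding w_def by (rule weight_matrix_pos[OF pos_def])
  ultimately show False using Im by simp
qed

lemma dispersion_union_real: "\<omega> \<in> dispersion_union \<epsilon> \<mu> \<Longrightarrow> Im \<omega> = 0"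
  by (auto simp: dispersion_union_def dest: eigenfrequency_real)

text \<open>For real \<omega> the right-hand side of \<open>flux_identity\<close> is 0, so T^* J T
  has derivative 0 at regular points and is continuous across the others, hence takes the same value
  at z = 0 and z = 1.\<close>

lemma gap_index_real:
  assumes "Im \<omega> = 0"
  shows "gap_index \<epsilon> \<mu> \<omega> = 0"
proof -
  let ?J = flux_matrix
  define W where "W z = conj_transpose (T \<omega> z) ** ?J ** T \<omega> z" for z
  have c: "continuous_on UNIV W"
    unfolding W_def
    by (intro bounded_bilinear.continuous_on[OF bounded_bilinear_matrix_matrix_mult]
        bounded_linear.continuous_on[OF bounded_linear_conj_transpose] T_deriv continuous_on_const)
  have W': "(W has_vector_derivative 0) (at z)" if z: "z \<in> regular" for z
  proof -
    let ?T = "T \<omega> z" and ?S = "S \<omega> z"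
    have 1: "((\<lambda>z. conj_transpose (T \<omega> z)) has_vector_derivative conj_transpose (?S ** ?T)) (at z)"
      by (rule bounded_linear.has_vector_derivative[OF bounded_linear_conj_transpose T_deriv(2)[OF z]])
    have 2: "((\<lambda>z. conj_transpose (T \<omega> z) ** ?J) has_vector_derivative conj_transpose (?S ** ?T) ** ?J) (at z)"
      by (rule bounded_linear.has_vector_derivative[OF
            bounded_bilinear.bounded_linear_left[OF bounded_bilinear_matrix_matrix_mult] 1])
    have "((\<lambda>z. conj_transpose (T \<omega> z) ** ?J ** T \<omega> z) has_vector_derivative
        (conj_transpose ?T ** ?J ** (?S ** ?T) + conj_transpose (?S ** ?T) ** ?J ** ?T)) (at z)"
      by (rule bounded_bilinear.has_vector_derivative[OF bounded_bilinear_matrix_matrix_mult 2 T_deriv(2)[OF z]])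
    also have "conj_transpose ?T ** ?J ** (?S ** ?T) + conj_transpose (?S ** ?T) ** ?J ** ?T
        = conj_transpose ?T ** (conj_transpose ?S ** ?J + ?J ** ?S) ** ?T"
      by (simp add: conj_transpose_mult matrix_mul_assoc add.commute
          bounded_bilinear.add_left[OF bounded_bilinear_matrix_matrix_mult]
          bounded_bilinear.add_right[OF bounded_bilinear_matrix_matrix_mult])
    also have "conj_transpose ?S ** ?J + ?J ** ?S = 0"
      unfolding flux_identity[where \<epsilon> = \<epsilon> and \<mu> = \<mu>, OF pos_def] assms
      by (simp add: mat_mult_matrix vec_eq_iff)
    finally show ?thesis by (simp add: W_def[abs_def])
  qed
  have "((\<lambda>z. 0) has_integral (W 1 - W 0)) {0..1::real}"
    by (rule fundamental_theorem_of_calculus_interior_strong[where f = W, OF finite_irregular[of 0 1]])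
      (auto intro: W' continuous_on_subset[OF c])
  then have "W 1 = W 0"
    using has_integral_unique[OF has_integral_0] by fastforce
  moreover have "conj_transpose (mat 1 :: complex^(2+2)^(2+2)) = mat 1"
    by (simp add: conj_transpose_def mat_def vec_eq_iff)
  ultimately have "conj_transpose (monodromy \<epsilon> \<mu> \<omega>) ** ?J ** monodromy \<epsilon> \<mu> \<omega> = ?J"
    by (simp add: W_def T(2) monodromy_T)
  then show ?thesis
    using eigenvalues_symmetric[OF _ det_flux_matrix] by (simp add: gap_index_def)
qed

section \<open>The second-order problem for the electric field\<close>

lemma sum_fun_apply: "(\<Sum>i\<in>I. f i) z = (\<Sum>i\<in>I. f i z)"
  by (induction I rule: infinite_finite_induct) auto

lemma matrix_inv_mu:
  "matrix_inv (\<mu> z) *v u = v \<longleftrightarrow> u = \<mu> z *v v"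
proof -
  have i: "invertible (\<mu> z)" by (rule hermitian_pos_def_invertible[OF pos_def(2)])
  have 1: "\<mu> z ** matrix_inv (\<mu> z) = mat 1" by (rule matrix_inv_right[OF i])
  then have 2: "matrix_inv (\<mu> z) ** \<mu> z = mat 1"
    using matrix_left_right_inverse by blast
  show ?thesis
    using 1 2 by (metis matrix_vector_mul_assoc matrix_vector_mul_lid)
qed

text \<open>The quasi-derivative and the magnetic field are related by G = i\<omega> H, which can be
  solved for H when \<omega> \<noteq> 0. Quasi-periodicity is imposed on E alone, as in the
  definition of the space.\<close>

lemma electric_eigenspace_iff:
  fixes x :: real
  assumes x: "x \<noteq> 0"
  shows "E \<in> electric_eigenspace \<epsilon> \<mu> k (of_real (x\<^sup>2)) \<longleftrightarrow>
    (\<exists>\<Phi>. vector_solution (of_real x) \<Phi> \<and> E = (\<lambda>z. electric_part (\<Phi> z)) \<and>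
      (\<forall>z. E (z + 1) = exp (\<i> * of_real k) *s E z))"
proof
  assume "E \<in> electric_eigenspace \<epsilon> \<mu> k (of_real (x\<^sup>2))"
  then obtain G where E: "continuous_on UNIV E" "\<And>z. E (z + 1) = exp (\<i> * of_real k) *s E z"
    and G: "continuous_on UNIV G"
    and E': "\<And>z. coeffs_cont \<epsilon> \<mu> z \<Longrightarrow> \<exists>dE. (E has_vector_derivative dE) (at z) \<and>
                     G z = matrix_inv (\<mu> z) *v (rotQ *v dE)"
    and G': "\<And>z. coeffs_cont \<epsilon> \<mu> z \<Longrightarrow> \<exists>dG. (G has_vector_derivative dG) (at z) \<and>
                     rotQ *v dG = of_real (x\<^sup>2) *s (\<epsilon> z *v E z)"
    unfolding electric_eigenspace_def by blast
  define c where "c = inverse (\<i> * complex_of_real x)"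
  have c: "\<i> * of_real x * c = 1" "c * of_real (x\<^sup>2) = - (\<i> * of_real x)"
    using x by (simp_all add: c_def field_simps power2_eq_square)
  have bc: "bounded_linear (\<lambda>v :: complex^2. c *s v)"
    unfolding linear_conv_bounded_linear[symmetric] by (simp add: linear_iff vec_eq_iff algebra_simps)
  define \<Phi> where "\<Phi> z = join_parts (E z, c *s G z)" for z
  have "vector_solution (of_real x) \<Phi>"
    unfolding vector_solution_iff
  proof (intro conjI allI impI)
    show "continuous_on UNIV \<Phi>"
      unfolding \<Phi>_def
      by (intro bounded_linear.continuous_on[OF bounded_linear_parts(3)] continuous_on_Pair E
          bounded_linear.continuous_on[OF bc] G)
    fix z assume z: "coeffs_cont \<epsilon> \<mu> z"
    from E'[OF z] obtain dE where dE: "(E has_vector_derivative dE) (at z)"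
      "rotQ *v dE = \<mu> z *v G z" by (auto simp: eq_commute[of "G z"] matrix_inv_mu)
    from G'[OF z] obtain dG where dG: "(G has_vector_derivative dG) (at z)"
      "rotQ *v dG = of_real (x\<^sup>2) *s (\<epsilon> z *v E z)" by blast
    have d: "(\<Phi> has_vector_derivative join_parts (dE, c *s dG)) (at z)"
      unfolding \<Phi>_def
      by (intro bounded_linear.has_vector_derivative[OF bounded_linear_parts(3)]
          has_vector_derivative_Pair dE(1) bounded_linear.has_vector_derivative[OF bc] dG(1))
    have "dE = - (rotQ *v (\<mu> z *v G z))"
      using rotQ_rotQ[of dE] dE(2) by simp
    also have "\<dots> = - (\<i> * of_real x) *s (rotQ *v (\<mu> z *v (c *s G z)))"
      using c(1) by (simp add: vector_scalar_commute vector_smult_assoc)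
    finally have 1: "dE = - (\<i> * of_real x) *s (rotQ *v (\<mu> z *v (c *s G z)))" .
    have "dG = - (rotQ *v (of_real (x\<^sup>2) *s (\<epsilon> z *v E z)))"
      using rotQ_rotQ[of dG] dG(2) by simp
    then have "c *s dG = - ((c * of_real (x\<^sup>2)) *s (rotQ *v (\<epsilon> z *v E z)))"
      by (simp add: vector_scalar_commute vec_eq_iff)
    then have 2: "c *s dG = (\<i> * of_real x) *s (rotQ *v (\<epsilon> z *v E z))"
      unfolding c(2) by (simp add: vec_eq_iff)
    show "(\<Phi> has_vector_derivative S (of_real x) z *v \<Phi> z) (at z)"
      using d unfolding system_matrix_mult 1[symmetric] 2[symmetric] \<Phi>_def parts_join .
  qed
  then show "\<exists>\<Phi>. vector_solution (of_real x) \<Phi> \<and> E = (\<lambda>z. electric_part (\<Phi> z)) \<and>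
      (\<forall>z. E (z + 1) = exp (\<i> * of_real k) *s E z)"
    using E(2) by (intro exI[of _ \<Phi>]) (simp add: \<Phi>_def)
next
  assume "\<exists>\<Phi>. vector_solution (of_real x) \<Phi> \<and> E = (\<lambda>z. electric_part (\<Phi> z)) \<and>
      (\<forall>z. E (z + 1) = exp (\<i> * of_real k) *s E z)"
  then obtain \<Phi> where \<Phi>: "continuous_on UNIV \<Phi>"
      "\<And>z. coeffs_cont \<epsilon> \<mu> z \<Longrightarrow> (\<Phi> has_vector_derivative (S (of_real x) z *v \<Phi> z)) (at z)"
    and E: "E = (\<lambda>z. electric_part (\<Phi> z))" "\<And>z. E (z + 1) = exp (\<i> * of_real k) *s E z"
    by (auto simp: vector_solution_iff)
  let ?i = "\<i> * complex_of_real x"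
  define G where "G z = ?i *s magnetic_part (\<Phi> z)" for z
  have bi: "bounded_linear (\<lambda>v :: complex^2. ?i *s v)"
    unfolding linear_conv_bounded_linear[symmetric] by (simp add: linear_iff vec_eq_iff algebra_simps)
  have dE: "(E has_vector_derivative - ?i *s (rotQ *v (\<mu> z *v magnetic_part (\<Phi> z)))) (at z)"
    if z: "coeffs_cont \<epsilon> \<mu> z" for z
    unfolding E(1) system_matrix_mult_parts(1)[where \<epsilon> = \<epsilon>, symmetric]
    by (rule bounded_linear.has_vector_derivative[OF bounded_linear_parts(1) \<Phi>(2)[OF z]])
  have dG: "(G has_vector_derivative ?i *s (?i *s (rotQ *v (\<epsilon> z *v E z)))) (at z)"
    if z: "coeffs_cont \<epsilon> \<mu> z" for z
    unfolding E(1) G_def system_matrix_mult_parts(2)[where \<mu> = \<mu>, symmetric]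
    by (rule bounded_linear.has_vector_derivative[OF bi
          bounded_linear.has_vector_derivative[OF bounded_linear_parts(2) \<Phi>(2)[OF z]]])
  have "continuous_on UNIV E"
    unfolding E(1) by (rule bounded_linear.continuous_on[OF bounded_linear_parts(1) \<Phi>(1)])
  moreover have "continuous_on UNIV G"
    unfolding G_def
    by (rule bounded_linear.continuous_on[OF bi bounded_linear.continuous_on[OF bounded_linear_parts(2) \<Phi>(1)]])
  moreover have "G z = matrix_inv (\<mu> z) *v (rotQ *v (- ?i *s (rotQ *v (\<mu> z *v magnetic_part (\<Phi> z)))))" for z
  proof -
    have "rotQ *v (- ?i *s (rotQ *v (\<mu> z *v magnetic_part (\<Phi> z)))) = \<mu> z *v G z"
      unfolding vector_scalar_commute rotQ_rotQ G_def by (simp add: vec_eq_iff)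
    then show ?thesis using matrix_inv_mu by metis
  qed
  moreover have "rotQ *v (?i *s (?i *s (rotQ *v (\<epsilon> z *v E z)))) = of_real (x\<^sup>2) *s (\<epsilon> z *v E z)" for z
  proof -
    have "?i * ?i = - (complex_of_real x * complex_of_real x)" by (simp add: algebra_simps)
    then show ?thesis
      unfolding vector_scalar_commute rotQ_rotQ by (simp add: vec_eq_iff power2_eq_square)
  qed
  ultimately show "E \<in> electric_eigenspace \<epsilon> \<mu> k (of_real (x\<^sup>2))"
    unfolding electric_eigenspace_def using E(2) dE dG by blast
qed

text \<open>The dimension is the cardinality of a basis, and \<open>card\<close> of an infinite set
  is 0; the basis must be shown both finite and nonempty.\<close>

lemma electric_multiplicity_pos:
  assumes x: "x \<noteq> 0" and e: "eigenfrequency \<epsilon> \<mu> k (of_real x)"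
  shows "0 < electric_multiplicity \<epsilon> \<mu> k x"
proof -
  let ?V = "electric_eigenspace \<epsilon> \<mu> k (of_real (x\<^sup>2))"
  \<comment> \<open>The electric parts of the columns of the propagator span all electric fields of
    solutions, which bounds the dimension.\<close>
  define b where "b i = (\<lambda>z. electric_part (T (of_real x) z *v axis i 1))" for i
  have "E \<in> field_space.span (range b)" if "E \<in> ?V" for E
  proof -
    obtain \<Phi> where \<Phi>: "vector_solution (of_real x) \<Phi>" "E = (\<lambda>z. electric_part (\<Phi> z))"
      using \<open>E \<in> ?V\<close> unfolding electric_eigenspace_iff[OF x] by blast
    have "E = (\<Sum>i\<in>UNIV. (\<lambda>z. \<Phi> 0 $ i *s b i z))"
    proof
      fix z
      have "\<Phi> 0 = (\<Sum>i\<in>UNIV. \<Phi> 0 $ i *s axis i 1)"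
        by (simp add: basis_expansion)
      then have "\<Phi> z = T (of_real x) z *v (\<Sum>i\<in>UNIV. \<Phi> 0 $ i *s axis i 1)"
        using vector_solution_eq_T[OF \<Phi>(1), of z] by simp
      also have "\<dots> = (\<Sum>i\<in>UNIV. \<Phi> 0 $ i *s (T (of_real x) z *v axis i 1))"
        by (simp add: bounded_bilinear.sum_right[OF bounded_bilinear_matrix_vector_mult] vector_scalar_commute)
      finally have "E z = (\<Sum>i\<in>UNIV. electric_part (\<Phi> 0 $ i *s (T (of_real x) z *v axis i 1)))"
        using \<Phi>(2) by (simp add: bounded_linear.linear[OF bounded_linear_parts(1), THEN linear_sum])
      then show "E z = (\<Sum>i\<in>UNIV. (\<lambda>z. \<Phi> 0 $ i *s b i z)) z"
        by (simp add: sum_fun_apply b_def parts_smult)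
    qed
    then show ?thesis
      by (rule ssubst) (intro field_space.span_sum field_space.span_scale field_space.span_base rangeI)
  qed
  moreover obtain B where B: "B \<subseteq> ?V" "\<not> field_space.dependent B" "?V \<subseteq> field_space.span B"
      "card B = field_space.dim ?V"
    by (rule field_space.basis_exists)
  ultimately have "finite B"
    using field_space.independent_span_bound[of "range b" B] by auto
  moreover have "B \<noteq> {}"
  proof
    assume "B = {}"
    obtain \<Phi> y where \<Phi>: "vector_solution (of_real x) \<Phi>" "\<Phi> y \<noteq> 0"
        "\<And>z. \<Phi> (z + 1) = exp (\<i> * of_real k) *s \<Phi> z"
      using e by (auto simp: eigenfrequency_def vector_solution_iff)
    define E where "E z = electric_part (\<Phi> z)" for z
    have "E \<in> ?V"
      unfolding electric_eigenspace_iff[OF x] using \<Phi> by (auto simp: E_def[abs_def] parts_smult)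
    then have "E = 0" using B(3) \<open>B = {}\<close> by auto
    then have E0: "electric_part (\<Phi> z) = 0" for z by (metis E_def zero_fun_apply)
    obtain z where z: "z \<in> regular" using regular_between[of 0 1] by auto
    \<comment> \<open>If E vanishes identically, so does E' = -i\<omega> Q \<mu> H at a regular
      point, and the invertibility of Q and \<mu> forces H = 0 there; uniqueness then kills the
      whole solution.\<close>
    have "((\<lambda>s. electric_part (\<Phi> s)) has_vector_derivative electric_part (S (of_real x) z *v \<Phi> z)) (at z)"
      using \<Phi>(1) z by (intro bounded_linear.has_vector_derivative[OF bounded_linear_parts(1)])
        (auto simp: vector_solution_iff)
    then have "electric_part (S (of_real x) z *v \<Phi> z) = 0"
      unfolding E0 by (rule vector_derivative_unique_at[OF _ has_vector_derivative_const])
    then have "rotQ *v (\<mu> z *v magnetic_part (\<Phi> z)) = 0"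
      using x by (simp add: system_matrix_mult_parts)
    then have "\<mu> z *v magnetic_part (\<Phi> z) = 0"
      using rotQ_rotQ[of "\<mu> z *v magnetic_part (\<Phi> z)"] by simp
    then have "magnetic_part (\<Phi> z) = 0"
      using matrix_inv_mu[of z 0 "magnetic_part (\<Phi> z)"] by simp
    then have "\<Phi> z = join_parts (0, 0)"
      using join_parts_parts[of "\<Phi> z"] E0[of z] by simp
    also have "\<dots> = 0"
      using bounded_linear.linear[OF bounded_linear_parts(3), THEN linear_0] by (simp add: zero_prod_def)
    finally show False
      using vector_solution_0[OF \<Phi>(1), of z y] \<Phi>(2) by blast
  qed
  ultimately have "0 < card B" by (simp add: card_gt_0_iff)
  then show ?thesis unfolding electric_multiplicity_def B(4)[symmetric] .
qed

text \<open>An eigenfrequency x > 0 has positive multiplicity and so occurs in the list as some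
  \<open>w m\<close>. By monotonicity m \<le> n forces x \<le> \<open>w n\<close>, and m > n forces
  x \<ge> \<open>w (Suc n)\<close>.\<close>

lemma ordered_eigenfrequencies_gap:
  assumes w: "ordered_eigenfrequencies \<epsilon> \<mu> k w" and n: "1 \<le> n"
    and x: "0 < x" "w n < x" "x < w (Suc n)"
  shows "\<not> eigenfrequency \<epsilon> \<mu> k (of_real x)"
proof
  assume "eigenfrequency \<epsilon> \<mu> k (of_real x)"
  then have "0 < electric_multiplicity \<epsilon> \<mu> k x"
    using x(1) by (intro electric_multiplicity_pos) auto
  then have "0 < card {m. 1 \<le> m \<and> w m = x}"
    using w x(1) by (simp add: ordered_eigenfrequencies_def)
  then obtain m where m: "1 \<le> m" "w m = x" by (auto simp: card_gt_0_iff)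
  have mono: "w i \<le> w j" if "1 \<le> i" "i \<le> j" for i j
    using that(2,1)
    by (induction rule: dec_induct) (use w in \<open>auto simp: ordered_eigenfrequencies_def intro: order_trans\<close>)
  show False
    using mono[of m n] mono[of "Suc n" m] m n x by (cases "m \<le> n") auto
qed

section \<open>From the band gap to the topology of the complement\<close>

text \<open>Any x strictly between the maximum of one band and the minimum of the next lies in the
  gap for all k at once, and x > 0 because band functions are non-negative.\<close>

lemma band_gap_point:
  assumes "has_band_gap \<epsilon> \<mu>"
  obtains x :: real where "of_real x \<notin> dispersion_union \<epsilon> \<mu>"
proof -
  obtain w n k1 k2 where w: "\<And>k. k \<in> {-pi..pi} \<Longrightarrow> ordered_eigenfrequencies \<epsilon> \<mu> k (\<lambda>n. w n k)"
    and n: "1 \<le> n" and k1: "is_arg_max (w n) (\<lambda>k. k \<in> {-pi..pi}) k1"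
    and k2: "is_arg_min (w (Suc n)) (\<lambda>k. k \<in> {-pi..pi}) k2" and lt: "w n k1 < w (Suc n) k2"
    using assms unfolding has_band_gap_def by blast
  obtain x where x: "w n k1 < x" "x < w (Suc n) k2" using dense[OF lt] by blast
  have "0 \<le> w n k1"
    using w[of k1] k1 n by (auto simp: is_arg_max_def ordered_eigenfrequencies_def)
  have "\<not> eigenfrequency \<epsilon> \<mu> k (of_real x)" if k: "k \<in> {-pi..pi}" for k
  proof (rule ordered_eigenfrequencies_gap[OF w[OF k] n])
    show "0 < x" using x \<open>0 \<le> w n k1\<close> by simp
    show "w n k < x" using k1 k x(1) by (auto simp: is_arg_max_def not_less)
    show "x < w (Suc n) k" using k2 k x(2) by (auto simp: is_arg_min_def not_less)
  qed
  then have "of_real x \<notin> dispersion_union \<epsilon> \<mu>" by (auto simp: dispersion_union_def)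
  then show thesis by (rule that)
qed

text \<open>A real point of the complement is joined to a gap point through the upper half plane.\<close>

lemma connected_Compl_dispersion_union:
  assumes x: "of_real x \<notin> dispersion_union \<epsilon> \<mu>"
  shows "connected (UNIV - dispersion_union \<epsilon> \<mu>)"
proof -
  let ?D = "UNIV - dispersion_union \<epsilon> \<mu>"
  have D: "w \<in> ?D" if "Im w \<noteq> 0" for w
    using that dispersion_union_real by blast
  have seg: "path_component ?D w a" if "w \<in> ?D" "Im w = 0" "Im a \<noteq> 0" for w a
  proof -
    have "closed_segment w a \<subseteq> ?D"
    proof
      fix v assume "v \<in> closed_segment w a"
      then obtain t where t: "v = (1 - t) *\<^sub>R w + t *\<^sub>R a" by (auto simp: in_segment)
      show "v \<in> ?D"
      \<comment> \<open>Here Im v = t Im a, so \<open>w\<close> is the only real point of the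
        segment.\<close>
      proof (cases "t = 0")
        case True
        then show ?thesis using t that(1) by simp
      next
        case False
        then have "Im v \<noteq> 0" using t that by simp
        then show ?thesis by (rule D)
      qed
    qed
    then show ?thesis
      unfolding path_component_def by (intro exI[of _ "linepath w a"]) auto
  qed
  have X: "of_real x \<in> ?D" "Im (of_real x) = 0" using x by auto
  have "path_component ?D w (of_real x)" if w: "w \<in> ?D" for w
  proof (cases "Im w = 0")
    case True
    show ?thesis
      by (rule path_component_trans[OF seg[OF w True, of \<i>] path_component_sym[OF seg[OF X, of \<i>]]]) auto
  next
    case False
    show ?thesis by (rule path_component_sym[OF seg[OF X False]])
  qed
  then have "path_connected ?D"
    unfolding path_connected_component
    by (blast intro: path_component_trans path_component_sym)
  then show ?thesis by (rule path_connected_imp_connected)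
qed

text \<open>The imaginary axis without its origin already lies in the complement.\<close>

lemma unbounded_Compl_dispersion_union: "\<not> bounded (UNIV - dispersion_union \<epsilon> \<mu>)"
proof
  assume "bounded (UNIV - dispersion_union \<epsilon> \<mu>)"
  then obtain B where B: "\<And>w. w \<in> UNIV - dispersion_union \<epsilon> \<mu> \<Longrightarrow> norm w \<le> B"
    by (auto simp: bounded_iff)
  define w where "w = \<i> * of_real (\<bar>B\<bar> + 1)"
  have "Im w \<noteq> 0" "norm w > B" by (auto simp: w_def norm_mult)
  then show False using B[of w] dispersion_union_real[of w] by fastforce
qed

end

theorem theorem10:
  fixes \<epsilon>\<^sub>H \<mu>\<^sub>H :: "real \<Rightarrow> complex^2^2"
    and \<Gamma>\<^sub>0 \<Gamma>\<^sub>0c :: "complex set"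
  assumes "hermitian_crystal \<epsilon>\<^sub>H \<mu>\<^sub>H"
    and "\<Gamma>\<^sub>0 = dispersion_union \<epsilon>\<^sub>H \<mu>\<^sub>H"
    and "\<Gamma>\<^sub>0c = UNIV - \<Gamma>\<^sub>0"
    and "has_band_gap \<epsilon>\<^sub>H \<mu>\<^sub>H"
  shows "open \<Gamma>\<^sub>0c \<and> connected \<Gamma>\<^sub>0c \<and> \<not> bounded \<Gamma>\<^sub>0c \<and>
         principal_gapped_component \<epsilon>\<^sub>H \<mu>\<^sub>H \<Gamma>\<^sub>0c \<and>
         (\<forall>\<omega>\<in>\<Gamma>\<^sub>0c. gap_index \<epsilon>\<^sub>H \<mu>\<^sub>H \<omega> = 0)"
proof -
  interpret hermitian_medium \<epsilon>\<^sub>H \<mu>\<^sub>H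
    using assms(1) by unfold_locales (auto simp: hermitian_crystal_def)
  have D: "\<Gamma>\<^sub>0c = UNIV - dispersion_union \<epsilon>\<^sub>H \<mu>\<^sub>H" using assms(2,3) by simp
  obtain x :: real where x: "of_real x \<notin> dispersion_union \<epsilon>\<^sub>H \<mu>\<^sub>H"
    using band_gap_point[OF assms(4)] .
  then have xD: "of_real x \<in> \<Gamma>\<^sub>0c" by (simp add: D)
  have con: "connected \<Gamma>\<^sub>0c" unfolding D by (rule connected_Compl_dispersion_union[OF x])
  have ind: "gap_index \<epsilon>\<^sub>H \<mu>\<^sub>H \<omega> = 0" if "\<omega> \<in> \<Gamma>\<^sub>0c" for \<omega>
    using gap_index_constant[OF con _ that xD] gap_index_real[of "of_real x"] by (auto simp: D)
  \<comment> \<open>The common value is a definite description: over an empty set every constant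
    would qualify, so uniqueness uses the gap point.\<close>
  have "component_index \<epsilon>\<^sub>H \<mu>\<^sub>H \<Gamma>\<^sub>0c = 0"
    unfolding component_index_def using ind xD by (intro the_equality) auto
  moreover have "\<Gamma>\<^sub>0c \<in> components (UNIV - dispersion_union \<epsilon>\<^sub>H \<mu>\<^sub>H)"
    unfolding D[symmetric] using con xD by (auto simp: in_components_self)
  ultimately show ?thesis
    using con ind open_Compl_dispersion_union unbounded_Compl_dispersion_union
    by (simp add: principal_gapped_component_def D)
qed

end
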